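(* The complex tame Butcher group $\mathcal B^{\mathbb C}_{TM}$, endowed with the subspace topology induced by $M_{\mathbb C}$ and the global chart $\Psi\colon\mathcal B^{\mathbb C}_{TM}\to M^*_{\mathbb C}$, $a\mapsto a-e$, is a complex analytic Lie group modelled on the Silva space $M^*_{\mathbb C}$ (i.e. the group multiplication and inversion are complex analytic).
   Context: $\mathcal T_0$ is the set of rooted trees (finite, up to root-preserving isomorphism) together with the empty tree $\emptyset$; $|\tau|$ is the number of vertices. The complex Butcher group $G^{\mathbb C}_{TM}=\{a\colon\mathcal T_0\to\mathbb C\mid a(\emptyset)=1\}$ has product $(a\cdot b)(\tau)=\sum_{s\in\mathrm{OST}(\tau)}b(s_\tau)\prod_{\theta\in\tau\setminus s}a(\theta)$ and inverse $a^{-1}(\tau)=\sum_{p\in\mathcal P(\tau)}(-1)^{\#(\tau\setminus p)}\prod_{\theta\in\tau\setminus p}a(\theta)$, where $\mathrm{OST}(\tau)$ is the set of ordered subtrees (vertex subsets connected in $\tau$ containing the root if nonempty), $s_\tau$ the induced rooted tree, $\tau\setminus s$ the forest remaining after deleting $s$ and adjacent edges, $\mathcal P(\tau)$ the set of subsets $p$ of edges, $\tau\setminus p$ the forest remaining after deleting the edges of $p$, $\#$ the number of trees; the unit is $e$ with $e(\emptyset)=1$ and $e(\tau)=0$ otherwise. $\mathcal B^{\mathbb C}_{TM}=\{a\in G^{\mathbb C}_{TM}\mid\exists C,K>0\ \forall\tau\ne\emptyset:\ |a(\tau)|\le CK^{|\tau|}\}$. With $\omega_k(\tau)=2^{-k|\tau|}$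 and Banach spaces $\mathbb C^{\mathcal T_0}(\omega_k)=\{a\mid\sup_\tau|a(\tau)|\omega_k(\tau)<\infty\}$, $M_{\mathbb C}=\bigcup_k\mathbb C^{\mathcal T_0}(\omega_k)$ carries the locally convex inductive limit topology (a Silva space) and $M^*_{\mathbb C}=\{a\in M_{\mathbb C}\mid a(\emptyset)=0\}$; $\mathcal B^{\mathbb C}_{TM}=e+M^*_{\mathbb C}$ as sets. Differentiability is in the sense of Bastiani/Keller ($C^r$ maps between locally convex spaces via continuous iterated directional derivatives); complex analytic means $C^\infty_{\mathbb C}$. *)

theory Defs
  imports "HOL-Analysis.Analysis" "HOL-Library.Multiset"
begin

text \<open>A rooted tree is a root together with the multiset of its subtrees.
  The set T_0 of the paper is rendered as rtree option, with None the empty tree.\<close>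

datatype rtree = Node "rtree multiset"

primrec tsz :: "rtree \<Rightarrow> nat" where
  "tsz (Node M) = 1 + sum_mset (image_mset tsz M)"

definition vsize :: "rtree option \<Rightarrow> nat" where
  "vsize t = (case t of None \<Rightarrow> 0 | Some x \<Rightarrow> tsz x)"

fun choices_list :: "'a multiset list \<Rightarrow> 'a multiset multiset" where
  "choices_list [] = {#{#}#}"
| "choices_list (X # Xs) =
     sum_mset (image_mset (\<lambda>x. image_mset (add_mset x) (choices_list Xs)) X)"

definition choices :: "'a multiset multiset \<Rightarrow> 'a multiset multiset" where
  "choices MM = choices_list (SOME xs. mset xs = MM)"

text \<open>Given, for each child of the root, the multiset of options
  (optional part attached to the root, forest split off), combine them into
  (component containing the root, forest of remaining trees).\<close>
definition combine ::
  "(rtree option \<times> rtree multiset) multiset multiset \<Rightarrow> (rtree \<times> rtree multiset) multiset" where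
  "combine MM = image_mset
     (\<lambda>ch. (Node (image_mset the (filter_mset (\<lambda>z. z \<noteq> None) (image_mset fst ch))),
            sum_mset (image_mset snd ch)))
     (choices MM)"

text \<open>Non-empty ordered subtrees s of a tree (vertex sets connected and containing the root),
  each listed with multiplicity, as pairs (s_tau, tau minus s).\<close>
primrec ost :: "rtree \<Rightarrow> (rtree \<times> rtree multiset) multiset" where
  "ost (Node M) = combine (image_mset (\<lambda>c.
       add_mset (None, {#c#}) (image_mset (\<lambda>(s, f). (Some s, f)) (ost c))) M)"

text \<open>Edge subsets p of a tree, listed as pairs (root component, other components)
  of the forest tau minus p.\<close>
primrec cuts :: "rtree \<Rightarrow> (rtree \<times> rtree multiset) multiset" where
  "cuts (Node M) = combine (image_mset (\<lambda>c.
       image_mset (\<lambda>(r, f). (Some r, f)) (cuts c)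
     + image_mset (\<lambda>(r, f). (None, add_mset r f)) (cuts c)) M)"

type_synonym vfun = "rtree option \<Rightarrow> complex"

definition bmult :: "vfun \<Rightarrow> vfun \<Rightarrow> vfun" where
  "bmult a b t = (case t of
      None \<Rightarrow> b None
    | Some \<tau> \<Rightarrow> b None * a (Some \<tau>)
        + (\<Sum>(s, f) \<in># ost \<tau>. b (Some s) * (\<Prod>\<theta>\<in>#f. a (Some \<theta>))))"

definition binv :: "vfun \<Rightarrow> vfun" where
  "binv a t = (case t of
      None \<Rightarrow> 1
    | Some \<tau> \<Rightarrow> (\<Sum>(r, f) \<in># cuts \<tau>.
          (-1) ^ (size f + 1) * (a (Some r) * (\<Prod>\<theta>\<in>#f. a (Some \<theta>)))))"

definition bunit :: vfun where
  "bunit t = (if t = None then 1 else 0)"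

definition tameB :: "vfun set" where
  "tameB = {a. a None = 1 \<and>
     (\<exists>C K. C > 0 \<and> K > 0 \<and> (\<forall>\<tau>. \<tau> \<noteq> None \<longrightarrow> cmod (a \<tau>) \<le> C * K ^ vsize \<tau>))}"

record 'v lcs =
  lc_carrier :: "'v set"
  lc_add :: "'v \<Rightarrow> 'v \<Rightarrow> 'v"
  lc_smul :: "complex \<Rightarrow> 'v \<Rightarrow> 'v"
  lc_top :: "'v topology"

definition lc_sub :: "'v lcs \<Rightarrow> 'v \<Rightarrow> 'v \<Rightarrow> 'v" where
  "lc_sub E x y = lc_add E x (lc_smul E (-1) y)"

definition lc_lim :: "'v lcs \<Rightarrow> (complex \<Rightarrow> 'v) \<Rightarrow> 'v \<Rightarrow> bool" where
  "lc_lim F g L \<longleftrightarrow> L \<in> topspace (lc_top F) \<and>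
     (\<forall>V. openin (lc_top F) V \<and> L \<in> V \<longrightarrow> (\<forall>\<^sub>F t in at (0::complex). g t \<in> V))"

fun ddiff :: "'a lcs \<Rightarrow> 'b lcs \<Rightarrow> ('a \<Rightarrow> 'b) \<Rightarrow> nat \<Rightarrow> 'a \<Rightarrow> (nat \<Rightarrow> 'a) \<Rightarrow> 'b" where
  "ddiff E F f 0 x hs = f x"
| "ddiff E F f (Suc k) x hs = (THE L. lc_lim F (\<lambda>t.
      lc_smul F (inverse t)
        (lc_sub F (ddiff E F f k (lc_add E x (lc_smul E t (hs k))) hs) (ddiff E F f k x hs))) L)"

text \<open>Complex C^infinity maps in the sense of Bastiani/Keller on an open subset U.\<close>
definition smoothC :: "'a lcs \<Rightarrow> 'b lcs \<Rightarrow> 'a set \<Rightarrow> ('a \<Rightarrow> 'b) \<Rightarrow> bool" where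
  "smoothC E F U f \<longleftrightarrow> openin (lc_top E) U \<and>
     (\<forall>k. \<forall>x\<in>U. \<forall>hs \<in> PiE {..<Suc k} (\<lambda>_. lc_carrier E).
        \<exists>L. lc_lim F (\<lambda>t. lc_smul F (inverse t)
          (lc_sub F (ddiff E F f k (lc_add E x (lc_smul E t (hs k))) hs) (ddiff E F f k x hs))) L) \<and>
     (\<forall>k. continuous_map
        (prod_topology (subtopology (lc_top E) U) (product_topology (\<lambda>_. lc_top E) {..<k}))
        (lc_top F) (\<lambda>(x, hs). ddiff E F f k x hs))"

definition vadd :: "vfun \<Rightarrow> vfun \<Rightarrow> vfun" where "vadd a b = (\<lambda>\<tau>. a \<tau> + b \<tau>)"
definition vsmul :: "complex \<Rightarrow> vfun \<Rightarrow> vfun" where "vsmul c a = (\<lambda>\<tau>. c * a \<tau>)"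
definition vsub :: "vfun \<Rightarrow> vfun \<Rightarrow> vfun" where "vsub a b = (\<lambda>\<tau>. a \<tau> - b \<tau>)"

definition omega :: "nat \<Rightarrow> rtree option \<Rightarrow> real" where
  "omega k \<tau> = (1/2) ^ (k * vsize \<tau>)"

definition Ek :: "nat \<Rightarrow> vfun set" where
  "Ek k = {a. bdd_above (range (\<lambda>\<tau>. cmod (a \<tau>) * omega k \<tau>))}"

definition wnorm :: "nat \<Rightarrow> vfun \<Rightarrow> real" where
  "wnorm k a = (SUP \<tau>. cmod (a \<tau>) * omega k \<tau>)"

definition Mspace :: "vfun set" where
  "Mspace = (\<Union>k. Ek k)"

text \<open>Seminorms on M continuous on every step E_k: these generate the
  locally convex inductive limit topology.\<close>
definition adm_seminorm :: "(vfun \<Rightarrow> real) \<Rightarrow> bool" where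
  "adm_seminorm p \<longleftrightarrow>
     (\<forall>a\<in>Mspace. p a \<ge> 0) \<and>
     (\<forall>a\<in>Mspace. \<forall>b\<in>Mspace. p (vadd a b) \<le> p a + p b) \<and>
     (\<forall>c. \<forall>a\<in>Mspace. p (vsmul c a) = cmod c * p a) \<and>
     (\<forall>k. \<exists>C. \<forall>a\<in>Ek k. p a \<le> C * wnorm k a)"

definition Mtop :: "vfun topology" where
  "Mtop = subtopology
     (topology_generated_by
        {{y\<in>Mspace. p (vsub y x) < 1} | p x. adm_seminorm p \<and> x \<in> Mspace})
     Mspace"

definition Mstar :: "vfun set" where
  "Mstar = {a\<in>Mspace. a None = 0}"

definition MstarS :: "vfun lcs" where
  "MstarS = \<lparr>lc_carrier = Mstar, lc_add = vadd, lc_smul = vsmul,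
             lc_top = subtopology Mtop Mstar\<rparr>"

definition Mstar2S :: "(vfun \<times> vfun) lcs" where
  "Mstar2S = \<lparr>lc_carrier = Mstar \<times> Mstar,
              lc_add = (\<lambda>(a, b) (c, d). (vadd a c, vadd b d)),
              lc_smul = (\<lambda>z (a, b). (vsmul z a, vsmul z b)),
              lc_top = prod_topology (subtopology Mtop Mstar) (subtopology Mtop Mstar)\<rparr>"

definition Psi :: "vfun \<Rightarrow> vfun" where "Psi a = vsub a bunit"
definition Psi_inv :: "vfun \<Rightarrow> vfun" where "Psi_inv x = vadd x bunit"

end

theory Submission
  imports Defs
begin

text \<open>Grouping the admissible cuts of a tree by the edges nearest to the root turns the sums over
  ordered subtrees and over edge subsets into recursions over the multiset of children.
  Associativity becomes coassociativity of these cuts, and the formula for the inverse solves the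
  recursion that characterises left inverses.

  For the topology, a seminorm that is continuous on all steps satisfies
  \<open>p a \<le> (\<Sum>\<tau>. |a \<tau>| * p (\<delta> \<tau>))\<close>, where \<open>\<delta> \<tau>\<close> is the indicator of \<open>\<tau>\<close> and \<open>p (\<delta> \<tau>)\<close>
  decays faster than any exponential in \<open>|\<tau>|\<close>. As there are at most \<open>4 ^ n\<close> trees with \<open>n\<close>
  vertices, the sets \<open>|a \<tau>| \<le> \<delta> * 2 ^ (\<kappa> |\<tau>| * |\<tau>|)\<close> with \<open>\<kappa>\<close> nondecreasing and unbounded
  form a basis of zero neighbourhoods, and these weights are supermultiplicative.

  At \<open>\<tau>\<close>, product and inverse are polynomials that are homogeneous of degree \<open>|\<tau>|\<close> if the variable
  belonging to \<open>t\<close> has weight \<open>|t|\<close>, with coefficient sum at most \<open>2 ^ |\<tau>|\<close>. This class of maps is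
  closed under directional derivatives, and supermultiplicativity makes all its members
  continuous.\<close>

section \<open>Group structure\<close>

text \<open>A zero neighbourhood of the inductive limit meets every step \<open>Ek k\<close>, so it
  contains elements of arbitrarily large exponential growth, and no single norm
  \<open>wnorm k\<close> bounds the perturbations in it. The weights \<open>wt \<kappa>\<close>
  replace this family of norms by one superexponential bound, and two properties of \<kappa> carry
  the estimates. Monotonicity gives \<open>\<kappa> n * n + \<kappa> m * m \<le> \<kappa> (n + m) *
  (n + m)\<close>, so a monomial whose weights add up to the size of the tree can be estimated
  factor by factor. Moreover \<open>\<kappa> - j\<close> is again nondecreasing and unbounded for
  every constant \<open>j\<close>, so every loss of the form \<open>2 ^ (j * n)\<close> can be
  absorbed. The number and size of the coefficients, the growth of the base point and the number of
  factors of a monomial are all losses of this kind. A directional derivative costs a factor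
  \<open>n \<le> 2 ^ n\<close>, so derivatives of every order keep exponential coefficient bounds.
  Difference quotients need less: for fixed point and directions their error is linear in the
  increment within one step \<open>Ek j\<close>.\<close>

lemma image_mset_sum_mset: "image_mset f (\<Sum>x\<in>#X. g x) = (\<Sum>x\<in>#X. image_mset f (g x))"
  by (induction X) auto

text \<open>\<open>choices\<close> works on an arbitrarily chosen listing of the multiset.
  Left-commutativity makes the result independent of the listing and turns it into a
  \<open>fold_mset\<close>, which has a recursion.\<close>

lemma comp_fun_commute_choices:
  "comp_fun_commute (\<lambda>(X :: 'a multiset) C. \<Sum>x\<in>#X. image_mset (add_mset x) C)"
proof
  fix X Y :: "'a multiset"
  have "(\<Sum>y\<in>#Y. image_mset (add_mset y) (\<Sum>x\<in>#X. image_mset (add_mset x) C))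
      = (\<Sum>x\<in>#X. image_mset (add_mset x) (\<Sum>y\<in>#Y. image_mset (add_mset y) C))" for C
    unfolding image_mset_sum_mset multiset.map_comp o_def
    by (subst sum_mset.swap) (simp add: add_mset_commute)
  then show "(\<lambda>C. \<Sum>x\<in>#Y. image_mset (add_mset x) C) \<circ> (\<lambda>C. \<Sum>x\<in>#X. image_mset (add_mset x) C)
    = (\<lambda>C. \<Sum>x\<in>#X. image_mset (add_mset x) C) \<circ> (\<lambda>C. \<Sum>x\<in>#Y. image_mset (add_mset x) C)"
    by (simp add: fun_eq_iff)
qed

lemma choices_list_eq_fold:
  "choices_list Xs = fold_mset (\<lambda>X C. \<Sum>x\<in>#X. image_mset (add_mset x) C) {#{#}#} (mset Xs)"
proof -
  interpret comp_fun_commute "\<lambda>(X :: 'a multiset) C. \<Sum>x\<in>#X. image_mset (add_mset x) C"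
    by (rule comp_fun_commute_choices)
  show ?thesis by (induction Xs) auto
qed

lemma choices_eq_fold:
  "choices MM = fold_mset (\<lambda>X C. \<Sum>x\<in>#X. image_mset (add_mset x) C) {#{#}#} MM"
  unfolding choices_def choices_list_eq_fold
  by (metis (mono_tags, lifting) ex_mset someI_ex)

lemma choices_empty [simp]: "choices {#} = {#{#}#}"
  by (simp add: choices_eq_fold)

lemma choices_add_mset:
  "choices (add_mset X MM) = (\<Sum>x\<in>#X. image_mset (add_mset x) (choices MM))"
proof -
  interpret comp_fun_commute "\<lambda>(X :: 'a multiset) C. \<Sum>x\<in>#X. image_mset (add_mset x) C"
    by (rule comp_fun_commute_choices)
  show ?thesis by (simp add: choices_eq_fold)
qed

section \<open>Recursions over the children for ordered subtrees and edge subsets\<close>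

definition opt_mset :: "'a option \<Rightarrow> 'a multiset" where
  "opt_mset z = (case z of None \<Rightarrow> {#} | Some s \<Rightarrow> {#s#})"

lemma opt_mset_simps [simp]: "opt_mset None = {#}" "opt_mset (Some s) = {#s#}"
  by (simp_all add: opt_mset_def)

text \<open>\<open>combine\<close> before the new root is put on: the retained part remains a
  forest, and a forest can be assembled child by child.\<close>

definition comb ::
  "('c \<Rightarrow> (rtree option \<times> rtree multiset) multiset) \<Rightarrow> 'c multiset \<Rightarrow> (rtree multiset \<times> rtree multiset) multiset"
  where "comb G M = image_mset (\<lambda>ch. (\<Sum>z\<in>#ch. opt_mset (fst z), \<Sum>z\<in>#ch. snd z)) (choices (image_mset G M))"

lemma comb_empty [simp]: "comb G {#} = {#({#}, {#})#}"
  by (simp add: comb_def)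

lemma comb_add_mset:
  "comb G (add_mset c M) =
    (\<Sum>(z, f)\<in>#G c. image_mset (\<lambda>(K, F). (opt_mset z + K, f + F)) (comb G M))"
  by (simp add: comb_def choices_add_mset image_mset_sum_mset multiset.map_comp o_def case_prod_unfold)

lemma combine_eq_comb:
  "combine (image_mset G M) = image_mset (\<lambda>(K, F). (Node K, F)) (comb G M)"
proof -
  have "image_mset the (filter_mset (\<lambda>z. z \<noteq> None) (image_mset fst ch)) = (\<Sum>z\<in>#ch. opt_mset (fst z))"
    for ch :: "(rtree option \<times> rtree multiset) multiset"
    by (induction ch) (auto simp: opt_mset_def split: option.splits)
  then show ?thesis
    by (simp add: combine_def comb_def multiset.map_comp o_def)
qed

lemma sum_mset_sum_mset: "(\<Sum>y\<in>#(\<Sum>x\<in>#X. g x). f y) = (\<Sum>x\<in>#X. \<Sum>y\<in>#g x. f y)"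
  by (induction X) auto

lemma sum_comb_add_mset:
  "(\<Sum>(K, F)\<in>#comb G (add_mset c M). \<phi> K F) =
    (\<Sum>(z, f)\<in>#G c. \<Sum>(K, F)\<in>#comb G M. \<phi> (opt_mset z + K) (f + F))"
  by (simp add: comb_add_mset sum_mset_sum_mset multiset.map_comp o_def case_prod_unfold)

definition ost_opts :: "rtree \<Rightarrow> (rtree option \<times> rtree multiset) multiset" where
  "ost_opts c = add_mset (None, {#c#}) (image_mset (\<lambda>(s, f). (Some s, f)) (ost c))"

definition cut_opts :: "rtree \<Rightarrow> (rtree option \<times> rtree multiset) multiset" where
  "cut_opts c = image_mset (\<lambda>(r, f). (Some r, f)) (cuts c)
     + image_mset (\<lambda>(r, f). (None, add_mset r f)) (cuts c)"

lemma ost_Node: "ost (Node M) = image_mset (\<lambda>(K, F). (Node K, F)) (comb ost_opts M)"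
  unfolding combine_eq_comb [symmetric] ost_opts_def by simp

lemma cuts_Node: "cuts (Node M) = image_mset (\<lambda>(K, F). (Node K, F)) (comb cut_opts M)"
  unfolding combine_eq_comb [symmetric] cut_opts_def by simp

declare ost.simps [simp del] cuts.simps [simp del]

text \<open>The Connes-Kreimer coproduct of the forest \<open>M\<close> as a sum: \<open>K\<close>
  is the part near the roots, \<open>F\<close> the pruned trees. The trees count as planted, so a
  tree may also be pruned as a whole. With \<phi> curried, iterated coproducts are nested
  sums.\<close>

definition cop_sum :: "rtree multiset \<Rightarrow> (rtree multiset \<Rightarrow> rtree multiset \<Rightarrow> 'a) \<Rightarrow> 'a::comm_monoid_add"
  where "cop_sum M \<phi> = (\<Sum>(K, F)\<in>#comb ost_opts M. \<phi> K F)"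

text \<open>The edges above the trees of \<open>M\<close> take part as well; in
  \<open>Node M\<close> they are the edges at the root.\<close>

definition cut_sum :: "rtree multiset \<Rightarrow> (rtree multiset \<Rightarrow> rtree multiset \<Rightarrow> 'a) \<Rightarrow> 'a::comm_monoid_add"
  where "cut_sum M \<phi> = (\<Sum>(K, F)\<in>#comb cut_opts M. \<phi> K F)"

lemma cop_sum_empty [simp]: "cop_sum {#} \<phi> = \<phi> {#} {#}"
  by (simp add: cop_sum_def)

lemma cut_sum_empty [simp]: "cut_sum {#} \<phi> = \<phi> {#} {#}"
  by (simp add: cut_sum_def)

lemma cop_sum_add_mset [simp]:
  "cop_sum (add_mset (Node N) M) \<phi> = cop_sum M (\<lambda>K F. \<phi> K (add_mset (Node N) F))
    + cop_sum N (\<lambda>K F. cop_sum M (\<lambda>K' F'. \<phi> (add_mset (Node K) K') (F + F')))"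
  unfolding cop_sum_def sum_comb_add_mset
  by (simp add: ost_opts_def ost_Node multiset.map_comp o_def case_prod_unfold)

lemma cut_sum_add_mset [simp]:
  "cut_sum (add_mset (Node N) M) \<phi> =
      cut_sum N (\<lambda>K F. cut_sum M (\<lambda>K' F'. \<phi> (add_mset (Node K) K') (F + F')))
    + cut_sum N (\<lambda>K F. cut_sum M (\<lambda>K' F'. \<phi> K' (add_mset (Node K) (F + F'))))"
  unfolding cut_sum_def sum_comb_add_mset
  by (simp add: cut_opts_def cuts_Node multiset.map_comp o_def case_prod_unfold)

lemma sum_ost: "(\<Sum>(s, f)\<in>#ost (Node M). \<phi> s f) = cop_sum M (\<lambda>K F. \<phi> (Node K) F)"
  by (simp add: cop_sum_def ost_Node multiset.map_comp o_def case_prod_unfold)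

lemma sum_cuts: "(\<Sum>(s, f)\<in>#cuts (Node M). \<phi> s f) = cut_sum M (\<lambda>K F. \<phi> (Node K) F)"
  by (simp add: cut_sum_def cuts_Node multiset.map_comp o_def case_prod_unfold)

lemma cop_sum_add: "cop_sum M (\<lambda>K F. \<phi> K F + \<psi> K F) = cop_sum M \<phi> + cop_sum M \<psi>"
  by (simp add: cop_sum_def case_prod_unfold sum_mset.distrib)

lemma cop_sum_swap:
  "cop_sum M (\<lambda>K F. cop_sum N (\<lambda>K' F'. \<phi> K F K' F')) = cop_sum N (\<lambda>K' F'. cop_sum M (\<lambda>K F. \<phi> K F K' F'))"
  unfolding cop_sum_def case_prod_unfold by (rule sum_mset.swap)

lemma cop_sum_mult_left:
  fixes c :: "'a::comm_semiring_0"
  shows "cop_sum M (\<lambda>K F. c * \<phi> K F) = c * cop_sum M \<phi>"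
  by (simp add: cop_sum_def case_prod_unfold sum_mset_distrib_left)

lemma cut_sum_mult_left:
  fixes c :: "'a::comm_semiring_0"
  shows "cut_sum M (\<lambda>K F. c * \<phi> K F) = c * cut_sum M \<phi>"
  by (simp add: cut_sum_def case_prod_unfold sum_mset_distrib_left)

section \<open>Coassociativity and the group laws\<close>

lemma tsz_pos: "0 < tsz t"
  by (cases t) auto

text \<open>Removes one root at a time: \<open>N\<close> is the forest below it, \<open>M\<close>
  the rest. Both have fewer vertices, so trees and forests need no simultaneous induction.\<close>

lemma rforest_induct [case_names empty add]:
  assumes "P {#}" and "\<And>N M. P N \<Longrightarrow> P M \<Longrightarrow> P (add_mset (Node N) M)"
  shows "P M"
proof (induction "\<Sum>t\<in>#M. tsz t" arbitrary: M rule: less_induct)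
  case less
  show ?case
  proof (cases M)
    case empty
    then show ?thesis using assms(1) by simp
  next
    case (add t M')
    obtain N where "t = Node N" by (cases t)
    then show ?thesis using add assms(2)[of N M'] less by simp
  qed
qed

lemma cop_sum_union:
  "cop_sum (M + N) \<phi> = cop_sum M (\<lambda>K F. cop_sum N (\<lambda>K' F'. \<phi> (K + K') (F + F')))"
  by (induction M arbitrary: \<phi> rule: rforest_induct) (simp_all add: cop_sum_add add.assoc)

text \<open>Both sides run over the pairs of nested cuts that divide \<open>M\<close> into three
  layers; they differ in which of the two cuts is made first. The induction distinguishes the layer
  that receives the root of the new tree. If that is the outermost layer, the whole tree lies there
  and the induction hypothesis for \<open>M\<close> applies directly.\<close>

lemma cop_sum_coassoc:
  "cop_sum M (\<lambda>K F. cop_sum F (\<lambda>F1 F2. \<phi> K F1 F2)) = cop_sum M (\<lambda>K F. cop_sum K (\<lambda>K1 K2. \<phi> K1 K2 F))"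
proof (induction M arbitrary: \<phi> rule: rforest_induct)
  case empty
  show ?case by simp
next
  case (add N M)
  \<comment> \<open>The new root lies in the middle layer, so only one cut passes through
    \<open>N\<close>.\<close>
  have 1: "cop_sum M (\<lambda>K F. cop_sum N (\<lambda>G1 G2. cop_sum F (\<lambda>F1 F2. \<phi> K (add_mset (Node G1) F1) (G2 + F2))))
      = cop_sum N (\<lambda>K F. cop_sum M (\<lambda>K' F'. cop_sum K' (\<lambda>K1 K2. \<phi> K1 (add_mset (Node K) K2) (F + F'))))"
    by (subst cop_sum_swap) (simp add: add.IH(2))
  \<comment> \<open>The new root lies in the innermost layer. Both cuts pass through
    \<open>N\<close> and \<open>M\<close>, and the two forests are recut one after the
    other.\<close>
  have "cop_sum N (\<lambda>K F. cop_sum M (\<lambda>K' F'. cop_sum F (\<lambda>F1 F2. cop_sum F' (\<lambda>F1' F2'.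
          \<phi> (add_mset (Node K) K') (F1 + F1') (F2 + F2')))))
      = cop_sum N (\<lambda>K F. cop_sum F (\<lambda>F1 F2. cop_sum M (\<lambda>K' F'. cop_sum F' (\<lambda>F1' F2'.
          \<phi> (add_mset (Node K) K') (F1 + F1') (F2 + F2')))))"
    by (subst cop_sum_swap) simp
  also have "\<dots> = cop_sum N (\<lambda>K F. cop_sum F (\<lambda>F1 F2. cop_sum M (\<lambda>K' F'. cop_sum K' (\<lambda>A' B'.
          \<phi> (add_mset (Node K) A') (F1 + B') (F2 + F')))))"
    by (simp add: add.IH(2))
  also have "\<dots> = cop_sum N (\<lambda>K F. cop_sum K (\<lambda>A B. cop_sum M (\<lambda>K' F'. cop_sum K' (\<lambda>A' B'.
          \<phi> (add_mset (Node A) A') (B + B') (F + F')))))"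
    by (rule add.IH(1))
  also have "\<dots> = cop_sum N (\<lambda>K F. cop_sum M (\<lambda>K' F'. cop_sum K (\<lambda>A B. cop_sum K' (\<lambda>A' B'.
          \<phi> (add_mset (Node A) A') (B + B') (F + F')))))"
    by (subst cop_sum_swap) simp
  finally have 2: "cop_sum N (\<lambda>K F. cop_sum M (\<lambda>K' F'. cop_sum F (\<lambda>F1 F2. cop_sum F' (\<lambda>F1' F2'.
          \<phi> (add_mset (Node K) K') (F1 + F1') (F2 + F2'))))) = \<dots>" .
  show ?case
    by (simp add: cop_sum_union cop_sum_add 1 2 add.IH(2) add.assoc)
qed

definition forest_val :: "vfun \<Rightarrow> rtree multiset \<Rightarrow> complex" where
  "forest_val a F = (\<Prod>\<theta>\<in>#F. a (Some \<theta>))"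

lemma forest_val_simps [simp]:
  "forest_val a {#} = 1"
  "forest_val a (add_mset t F) = a (Some t) * forest_val a F"
  "forest_val a (F + G) = forest_val a F * forest_val a G"
  by (simp_all add: forest_val_def)

lemma bmult_Node:
  "bmult a b (Some (Node M)) =
    b None * a (Some (Node M)) + cop_sum M (\<lambda>K F. b (Some (Node K)) * forest_val a F)"
  by (simp add: bmult_def sum_ost forest_val_def)

lemma bmult_None [simp]: "bmult a b None = b None"
  by (simp add: bmult_def)

lemma vfun_eqI:
  assumes "a None = b None" "\<And>M. a (Some (Node M)) = b (Some (Node M))"
  shows "a = (b :: vfun)"
  using assms by (metis ext not_Some_eq rtree.exhaust)

text \<open>Convolution of multiplicative functionals is multiplicative. The summand
  \<open>b None * a (Some (Node N))\<close> of \<open>bmult\<close> is the cut that prunes the whole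
  tree, which has the value required by \<open>cop_sum\<close> if \<open>b None = 1\<close>.\<close>

lemma forest_val_bmult:
  assumes "b None = 1"
  shows "forest_val (bmult a b) M = cop_sum M (\<lambda>K F. forest_val b K * forest_val a F)"
proof (induction M rule: rforest_induct)
  case empty
  show ?case by simp
next
  case (add N M)
  have "cop_sum N (\<lambda>K F. cop_sum M (\<lambda>K' F'. b (Some (Node K)) * forest_val b K' * (forest_val a F * forest_val a F')))
     = cop_sum N (\<lambda>K F. b (Some (Node K)) * forest_val a F) * cop_sum M (\<lambda>K F. forest_val b K * forest_val a F)"
    by (simp add: cop_sum_mult_left [symmetric] mult_ac)
  moreover have "cop_sum M (\<lambda>K F. forest_val b K * (a (Some (Node N)) * forest_val a F))
     = a (Some (Node N)) * cop_sum M (\<lambda>K F. forest_val b K * forest_val a F)"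
    by (simp add: cop_sum_mult_left [symmetric] mult_ac)
  ultimately show ?case
    using add.IH(2) by (simp add: bmult_Node assms distrib_right)
qed

lemma bmult_assoc:
  assumes "b None = 1" "c None = 1"
  shows "bmult (bmult a b) c = bmult a (bmult b c)"
proof (rule vfun_eqI)
  fix M
  have "cop_sum M (\<lambda>K F. c (Some (Node K)) * cop_sum F (\<lambda>F1 F2. forest_val b F1 * forest_val a F2))
      = cop_sum M (\<lambda>K F. cop_sum K (\<lambda>K1 K2. c (Some (Node K1)) * forest_val b K2) * forest_val a F)"
    using cop_sum_coassoc [of M "\<lambda>K F1 F2. c (Some (Node K)) * (forest_val b F1 * forest_val a F2)"]
    by (simp add: cop_sum_mult_left [symmetric] mult_ac)
  then show "bmult (bmult a b) c (Some (Node M)) = bmult a (bmult b c) (Some (Node M))"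
    by (simp add: bmult_Node forest_val_bmult assms distrib_right cop_sum_add)
qed simp

lemma cop_sum_0 [simp]: "cop_sum M (\<lambda>K F. 0) = 0"
  by (simp add: cop_sum_def case_prod_unfold)

lemma bunit_simps [simp]: "bunit None = 1" "bunit (Some t) = 0"
  by (simp_all add: bunit_def)

text \<open>The counit law: \<open>forest_val bunit F\<close> vanishes unless \<open>F\<close> is
  empty, so only the cut that prunes nothing survives.\<close>

lemma cop_sum_forest_val_bunit:
  "cop_sum M (\<lambda>K F. \<phi> K * forest_val bunit F) = \<phi> M"
proof (induction M arbitrary: \<phi> rule: rforest_induct)
  case (add N M)
  have "cop_sum M (\<lambda>K' F'. \<phi> (add_mset (Node K) K') * (forest_val bunit F * forest_val bunit F'))
      = \<phi> (add_mset (Node K) M) * forest_val bunit F" for K F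
    using cop_sum_mult_left [of M "forest_val bunit F" "\<lambda>K' F'. \<phi> (add_mset (Node K) K') * forest_val bunit F'"]
    by (simp add: add.IH(2)) (simp add: mult_ac)
  then show ?case by (simp add: add.IH(1))
qed simp

lemma bmult_bunit_left: "bmult bunit a = a"
  by (rule vfun_eqI) (simp_all add: bmult_Node cop_sum_forest_val_bunit)

lemma bmult_bunit_right: "a None = 1 \<Longrightarrow> bmult a bunit = a"
  by (rule vfun_eqI) (simp_all add: bmult_Node)

lemma binv_None [simp]: "binv a None = 1"
  by (simp add: binv_def)

lemma forest_val_uminus: "forest_val (- a) F = (-1) ^ size F * forest_val a F"
  by (induction F) auto

text \<open>The exponent \<open>size f + 1\<close> counts all components, including that of the
  root; giving each component one sign makes every summand multiplicative in
  \<open>- a\<close>.\<close>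

lemma binv_Node:
  "binv a (Some (Node M)) = cut_sum M (\<lambda>K F. (- a) (Some (Node K)) * forest_val (- a) F)"
  by (simp add: binv_def sum_cuts forest_val_uminus) (simp add: forest_val_def mult_ac)

text \<open>An edge subset is the set of its edges nearest to the root together with edge subsets of the
  trees that these edges split off; the latter sum up to \<open>binv\<close>.\<close>
lemma cut_sum_eq_cop_sum:
  "cut_sum M (\<lambda>K F. \<phi> K * forest_val (- a) F) = cop_sum M (\<lambda>K F. \<phi> K * forest_val (binv a) F)"
proof (induction M arbitrary: \<phi> rule: rforest_induct)
  case empty
  show ?case by simp
next
  case (add N M)
  have "cut_sum N (\<lambda>K F. cut_sum M (\<lambda>K' F'. \<phi> (add_mset (Node K) K') * (forest_val (- a) F * forest_val (- a) F')))
     = cut_sum N (\<lambda>K F. cut_sum M (\<lambda>K' F'. \<phi> (add_mset (Node K) K') * forest_val (- a) F') * forest_val (- a) F)"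
    by (simp add: cut_sum_mult_left [symmetric] mult_ac)
  also have "\<dots> = cop_sum N (\<lambda>K F. cop_sum M (\<lambda>K' F'. \<phi> (add_mset (Node K) K') * (forest_val (binv a) F * forest_val (binv a) F')))"
    unfolding add.IH by (simp add: cop_sum_mult_left [symmetric] mult_ac)
  finally have 1: "cut_sum N (\<lambda>K F. cut_sum M (\<lambda>K' F'. \<phi> (add_mset (Node K) K') * (forest_val (- a) F * forest_val (- a) F')))
    = \<dots>" .
  \<comment> \<open>The edge above \<open>Node N\<close> is cut. The edge subsets inside this tree
    then sum up to \<open>binv a (Some (Node N))\<close>, matching the term of
    \<open>cop_sum\<close> that prunes the whole tree. Fact 1 was the case where the edge is
    kept.\<close>
  have "cut_sum N (\<lambda>K F. cut_sum M (\<lambda>K' F'. \<phi> K' * ((- a) (Some (Node K)) * (forest_val (- a) F * forest_val (- a) F'))))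
     = cut_sum N (\<lambda>K F. cut_sum M (\<lambda>K' F'. \<phi> K' * forest_val (- a) F') * ((- a) (Some (Node K)) * forest_val (- a) F))"
    by (simp add: cut_sum_mult_left [symmetric] mult_ac)
  also have "\<dots> = cut_sum M (\<lambda>K' F'. \<phi> K' * forest_val (- a) F') * binv a (Some (Node N))"
    unfolding binv_Node cut_sum_mult_left ..
  also have "\<dots> = cop_sum M (\<lambda>K' F'. \<phi> K' * (binv a (Some (Node N)) * forest_val (binv a) F'))"
    unfolding add.IH by (simp add: cop_sum_mult_left [symmetric] mult_ac)
  finally have 2: "cut_sum N (\<lambda>K F. cut_sum M (\<lambda>K' F'. \<phi> K' * ((- a) (Some (Node K)) * (forest_val (- a) F * forest_val (- a) F'))))
     = \<dots>" .
  show ?case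
    unfolding cut_sum_add_mset cop_sum_add_mset forest_val_simps 1 2 by (rule add.commute)
qed

lemma cut_sum_uminus: "cut_sum M (\<lambda>K F. - \<phi> K F) = - cut_sum M (\<lambda>K F. \<phi> K F :: complex)"
  using cut_sum_mult_left [of M "-1" \<phi>] by simp

lemma bmult_binv_left:
  assumes "a None = 1"
  shows "bmult (binv a) a = bunit"
proof (rule vfun_eqI)
  fix M
  have "binv a (Some (Node M)) = - cop_sum M (\<lambda>K F. a (Some (Node K)) * forest_val (binv a) F)"
    by (simp add: binv_Node cut_sum_uminus cut_sum_eq_cop_sum [of M "\<lambda>K. a (Some (Node K))"])
  then show "bmult (binv a) a (Some (Node M)) = bunit (Some (Node M))"
    by (simp add: bmult_Node assms)
qed (simp add: assms)

text \<open>The usual argument that left inverses in a monoid are two-sided; \<open>binv a\<close>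
  has a left inverse in turn because \<open>binv a None = 1\<close>.\<close>

lemma bmult_binv_right:
  assumes "a None = 1"
  shows "bmult a (binv a) = bunit"
proof -
  let ?i = "binv a"
  have "bmult a ?i = bmult (bmult (binv ?i) ?i) (bmult a ?i)"
    by (simp add: bmult_binv_left bmult_bunit_left)
  also have "\<dots> = bmult (binv ?i) (bmult ?i (bmult a ?i))"
    by (rule bmult_assoc) simp_all
  also have "bmult ?i (bmult a ?i) = bmult (bmult ?i a) ?i"
    by (rule bmult_assoc [symmetric]) (simp_all add: assms)
  also have "\<dots> = ?i"
    by (simp add: bmult_binv_left assms bmult_bunit_left)
  also have "bmult (binv ?i) ?i = bunit"
    by (simp add: bmult_binv_left)
  finally show ?thesis .
qed

section \<open>Grading by the number of vertices, and the number of cuts\<close>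

definition fsz :: "rtree multiset \<Rightarrow> nat" where
  "fsz F = (\<Sum>t\<in>#F. tsz t)"

lemma fsz_simps [simp]:
  "fsz {#} = 0" "fsz (add_mset t F) = tsz t + fsz F" "fsz (F + G) = fsz F + fsz G"
  by (simp_all add: fsz_def)

lemma tsz_Node: "tsz (Node F) = Suc (fsz F)"
  by (simp add: fsz_def)

text \<open>The premise is restricted to the members of \<open>M\<close> so that the inductions on
  trees below can supply it from their hypotheses on the children.\<close>

lemma fsz_comb:
  assumes "\<And>c z f. (z, f) \<in># G c \<Longrightarrow> c \<in># M \<Longrightarrow> fsz (opt_mset z) + fsz f = tsz c"
    and "(K, F) \<in># comb G M"
  shows "fsz K + fsz F = fsz M"
  using assms
proof (induction M arbitrary: K F)
  case (add c M)
  from add.prems(2) obtain z f K' F' where *: "(z, f) \<in># G c" "(K', F') \<in># comb G M"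
      "K = opt_mset z + K'" "F = f + F'"
    by (auto simp: comb_add_mset)
  have "fsz (opt_mset z) + fsz f = tsz c"
    using * add.prems(1) by simp
  moreover have "fsz K' + fsz F' = fsz M"
    using add.IH [OF _ *(2)] add.prems(1) by simp
  ultimately show ?case
    using * by simp
qed simp

lemma tsz_ost: "(s, f) \<in># ost t \<Longrightarrow> tsz s + fsz f = tsz t"
proof (induction t arbitrary: s f)
  case (Node M)
  from Node.prems obtain K where K: "(K, f) \<in># comb ost_opts M" "s = Node K"
    by (auto simp: ost_Node)
  have "fsz K + fsz f = fsz M"
    by (rule fsz_comb [OF _ K(1)]) (auto simp: ost_opts_def dest: Node.IH)
  then show ?case using K(2) by (simp add: tsz_Node del: tsz.simps)
qed

lemma tsz_cuts: "(r, f) \<in># cuts t \<Longrightarrow> tsz r + fsz f = tsz t"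
proof (induction t arbitrary: r f)
  case (Node M)
  from Node.prems obtain K where K: "(K, f) \<in># comb cut_opts M" "r = Node K"
    by (auto simp: cuts_Node)
  have "fsz K + fsz f = fsz M"
    by (rule fsz_comb [OF _ K(1)]) (auto simp: cut_opts_def dest: Node.IH)
  then show ?case using K(2) by (simp add: tsz_Node del: tsz.simps)
qed

lemma size_comb_add_mset: "size (comb G (add_mset c M)) = size (G c) * size (comb G M)"
  by (simp add: comb_add_mset multiset.map_comp o_def case_prod_unfold)

text \<open>With the edges above its trees, \<open>M\<close> has \<open>fsz M\<close> edges. A cut
  is determined by its edges, so there are at most as many cuts as sets of edges.\<close>

lemma size_comb_ost: "size (comb ost_opts M) \<le> 2 ^ fsz M"
proof (induction M rule: rforest_induct)
  case (add N M)
  have "Suc (size (comb ost_opts N)) \<le> 2 ^ tsz (Node N)"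
    using add.IH(1) one_le_power [of "2 :: nat" "fsz N"]
    unfolding tsz_Node power_Suc by linarith
  then have "Suc (size (comb ost_opts N)) * size (comb ost_opts M) \<le> 2 ^ tsz (Node N) * 2 ^ fsz M"
    using add.IH(2) by (rule mult_le_mono)
  moreover have "size (ost_opts (Node N)) = Suc (size (comb ost_opts N))"
    by (simp add: ost_opts_def ost_Node)
  ultimately show ?case
    by (simp add: size_comb_add_mset power_add del: tsz.simps)
qed simp

lemma size_comb_cut: "size (comb cut_opts M) \<le> 2 ^ fsz M"
proof (induction M rule: rforest_induct)
  case (add N M)
  have "size (comb cut_opts N) + size (comb cut_opts N) \<le> 2 ^ tsz (Node N)"
    using add.IH(1) unfolding tsz_Node power_Suc by linarith
  then have "(size (comb cut_opts N) + size (comb cut_opts N)) * size (comb cut_opts M)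
      \<le> 2 ^ tsz (Node N) * 2 ^ fsz M"
    using add.IH(2) by (rule mult_le_mono)
  moreover have "size (cut_opts (Node N)) = size (comb cut_opts N) + size (comb cut_opts N)"
    by (simp add: cut_opts_def cuts_Node)
  ultimately show ?case
    by (simp add: size_comb_add_mset power_add del: tsz.simps)
qed simp

text \<open>The successor accounts for the empty subtree, that is, for the summand with
  \<open>b None\<close> in \<open>bmult\<close>.\<close>

lemma size_ost: "Suc (size (ost t)) \<le> 2 ^ tsz t"
proof (cases t)
  case (Node M)
  have "size (comb ost_opts M) + 1 \<le> 2 * 2 ^ fsz M"
    using size_comb_ost [of M] one_le_power [of "2 :: nat" "fsz M"] by linarith
  then show ?thesis using Node by (simp add: ost_Node tsz_Node del: tsz.simps)
qed

lemma size_cuts: "size (cuts t) \<le> 2 ^ tsz t"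
proof (cases t)
  case (Node M)
  have "size (comb cut_opts M) \<le> 2 * 2 ^ fsz M"
    using size_comb_cut [of M] by linarith
  then show ?thesis using Node by (simp add: cuts_Node tsz_Node del: tsz.simps)
qed

section \<open>Zero neighbourhoods in the inductive limit\<close>

text \<open>A stack machine reading bracket words: \<open>True\<close> opens a vertex, \<open>False\<close> closes it.\<close>
fun parse_step :: "rtree multiset list \<Rightarrow> bool \<Rightarrow> rtree multiset list" where
  "parse_step st True = {#} # st"
| "parse_step (M # M' # st) False = add_mset (Node M) M' # st"
| "parse_step st False = []"

text \<open>The stack is arbitrary because the word of a subforest is read with its ancestors still
  open.\<close>

lemma ex_forest_word:
  "\<exists>w. length w = 2 * fsz N \<and> (\<forall>M st. foldl parse_step (M # st) w = (N + M) # st)"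
proof (induction N rule: rforest_induct)
  case empty
  show ?case by (intro exI [of _ "[]"]) simp
next
  case (add N M)
  then obtain u v where u: "length u = 2 * fsz N" "\<And>M' st. foldl parse_step (M' # st) u = (N + M') # st"
    and v: "length v = 2 * fsz M" "\<And>M' st. foldl parse_step (M' # st) v = (M + M') # st"
    by blast
  show ?case
    by (intro exI [of _ "True # u @ False # v"]) (simp add: u v tsz_Node del: tsz.simps)
qed

lemma finite_card_trees:
  "finite {t. tsz t = n} \<and> card {t. tsz t = n} \<le> 4 ^ n"
proof -
  let ?W = "{w :: bool list. set w \<subseteq> UNIV \<and> length w = 2 * n}"
  have W: "finite ?W" "card ?W = 4 ^ n"
    using finite_lists_length_eq [of "UNIV :: bool set" "2 * n"] card_lists_length_eq [of "UNIV :: bool set" "2 * n"]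
    by (simp_all add: power_mult)
  \<comment> \<open>\<open>THE\<close> decodes the word of a tree, since a singleton multiset
    determines its element; its values on other words are irrelevant for a covering.\<close>
  have "{t. tsz t = n} \<subseteq> (\<lambda>w. THE t. foldl parse_step [{#}] w = [{#t#}]) ` ?W"
  proof
    fix t assume "t \<in> {t. tsz t = n}"
    then obtain w where "length w = 2 * n" "foldl parse_step [{#}] w = [{#t#}]"
      using ex_forest_word [of "{#t#}"] by auto
    then show "t \<in> (\<lambda>w. THE t. foldl parse_step [{#}] w = [{#t#}]) ` ?W"
      by (intro image_eqI [of _ _ w]) auto
  qed
  with W show ?thesis
    by (metis (no_types, lifting) card_image_le card_mono finite_imageI finite_subset le_trans)
qed

section \<open>The steps \<open>Ek k\<close> and their union\<close>

lemma vsize_simps [simp]: "vsize None = 0" "vsize (Some t) = tsz t"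
  by (simp_all add: vsize_def)

lemma finite_card_vsize:
  "finite {\<tau>. vsize \<tau> = n} \<and> card {\<tau>. vsize \<tau> = n} \<le> 4 ^ n"
proof (cases "n = 0")
  case True
  have "{\<tau>. vsize \<tau> = 0} = {None}"
    using tsz_pos by (auto simp: vsize_def split: option.splits) (metis not_less_zero not_Some_eq)
  with True show ?thesis by simp
next
  case False
  have "{\<tau>. vsize \<tau> = n} = Some ` {t. tsz t = n}"
    using False by (auto simp: vsize_def image_iff split: option.splits)
  then show ?thesis using finite_card_trees [of n]
    by (metis card_image_le finite_imageI le_trans)
qed

lemma Ek_iff: "a \<in> Ek k \<longleftrightarrow> (\<exists>W. \<forall>\<tau>. cmod (a \<tau>) \<le> W * 2 ^ (k * vsize \<tau>))"
  by (auto simp: Ek_def bdd_above_def omega_def divide_simps)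

lemma wnorm_upper: "a \<in> Ek k \<Longrightarrow> cmod (a \<tau>) \<le> wnorm k a * 2 ^ (k * vsize \<tau>)"
  using cSUP_upper [of \<tau> UNIV "\<lambda>\<tau>. cmod (a \<tau>) * omega k \<tau>"]
  by (simp add: Ek_def wnorm_def omega_def divide_simps)

lemma wnorm_least:
  assumes "\<And>\<tau>. cmod (a \<tau>) \<le> W * 2 ^ (k * vsize \<tau>)"
  shows "wnorm k a \<le> W"
  unfolding wnorm_def
proof (rule cSUP_least)
  fix \<tau>
  show "cmod (a \<tau>) * omega k \<tau> \<le> W"
    using assms [of \<tau>] by (simp add: omega_def divide_simps)
qed simp

lemma wnorm_nonneg: "a \<in> Ek k \<Longrightarrow> 0 \<le> wnorm k a"
  using wnorm_upper [of a k None] norm_ge_zero [of "a None"] by (simp del: norm_ge_zero)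

lemma Mspace_iff: "a \<in> Mspace \<longleftrightarrow> (\<exists>k W. \<forall>\<tau>. cmod (a \<tau>) \<le> W * 2 ^ (k * vsize \<tau>))"
  by (simp add: Mspace_def Ek_iff)

lemma Ek_mono: "k \<le> l \<Longrightarrow> Ek k \<subseteq> Ek l"
proof
  fix a assume kl: "k \<le> l" and "a \<in> Ek k"
  have "wnorm k a * 2 ^ (k * vsize \<tau>) \<le> wnorm k a * 2 ^ (l * vsize \<tau>)" for \<tau>
    using wnorm_nonneg [OF \<open>a \<in> Ek k\<close>] kl by (intro mult_left_mono power_increasing) auto
  then show "a \<in> Ek l"
    using wnorm_upper [OF \<open>a \<in> Ek k\<close>] unfolding Ek_iff by (meson order_trans)
qed

lemma Mspace_vadd:
  assumes "a \<in> Mspace" "b \<in> Mspace"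
  shows "vadd a b \<in> Mspace"
proof -
  from assms obtain i j where "a \<in> Ek i" "b \<in> Ek j"
    by (auto simp: Mspace_def)
  then have "a \<in> Ek (max i j)" "b \<in> Ek (max i j)"
    using Ek_mono [of i "max i j"] Ek_mono [of j "max i j"] by auto
  then have "cmod (vadd a b \<tau>) \<le> (wnorm (max i j) a + wnorm (max i j) b) * 2 ^ (max i j * vsize \<tau>)" for \<tau>
    using norm_triangle_mono [OF wnorm_upper wnorm_upper] by (simp add: vadd_def distrib_right)
  then show ?thesis unfolding Mspace_iff by blast
qed

lemma Mspace_vsmul:
  assumes "a \<in> Mspace"
  shows "vsmul c a \<in> Mspace"
proof -
  from assms obtain k W where "\<And>\<tau>. cmod (a \<tau>) \<le> W * 2 ^ (k * vsize \<tau>)"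
    by (auto simp: Mspace_iff)
  then have "cmod (vsmul c a \<tau>) \<le> (cmod c * W) * 2 ^ (k * vsize \<tau>)" for \<tau>
    by (simp add: vsmul_def norm_mult mult.assoc mult_left_mono)
  then show ?thesis unfolding Mspace_iff by blast
qed

lemma vsub_eq: "vsub a b = vadd a (vsmul (-1) b)"
  by (simp add: vsub_def vadd_def vsmul_def)

lemma Mspace_vsub: "a \<in> Mspace \<Longrightarrow> b \<in> Mspace \<Longrightarrow> vsub a b \<in> Mspace"
  by (simp add: vsub_eq Mspace_vadd Mspace_vsmul)

section \<open>Superexponential weights\<close>

definition superexp :: "(nat \<Rightarrow> nat) \<Rightarrow> bool" where
  "superexp \<kappa> \<longleftrightarrow> mono \<kappa> \<and> (\<forall>j. \<exists>n. j \<le> \<kappa> n)"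

definition wt :: "(nat \<Rightarrow> nat) \<Rightarrow> nat \<Rightarrow> real" where
  "wt \<kappa> n = 2 ^ (\<kappa> n * n)"

lemma wt_ge1: "1 \<le> wt \<kappa> n"
  by (simp add: wt_def)

lemma wt_pos: "0 < wt \<kappa> n"
  by (simp add: wt_def)

lemma superexp_diff: "superexp \<kappa> \<Longrightarrow> superexp (\<lambda>n. \<kappa> n - j)"
  unfolding superexp_def mono_def by (meson add_le_imp_le_diff diff_le_mono)

text \<open>The truncated subtraction only matters for finitely many \<open>n\<close>, hence the constant \<open>D\<close>.\<close>
lemma superexp_absorb:
  assumes "superexp \<kappa>"
  shows "\<exists>D\<ge>1. \<forall>n. wt (\<lambda>n. \<kappa> n - j) n * 2 ^ (j * n) \<le> D * wt \<kappa> n"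
proof -
  obtain m where m: "j \<le> \<kappa> m" and mono: "mono \<kappa>"
    using assms by (auto simp: superexp_def)
  have "wt (\<lambda>n. \<kappa> n - j) n * 2 ^ (j * n) \<le> 2 ^ (j * m) * wt \<kappa> n" for n
  proof -
    have "(\<kappa> n - j) * n + j * n \<le> j * m + \<kappa> n * n"
    proof (cases "j \<le> \<kappa> n")
      case True
      then show ?thesis by (simp flip: add_mult_distrib)
    next
      case False
      then have "n \<le> m" using m mono by (metis linear monoD order_trans)
      then show ?thesis using False by (simp add: trans_le_add1)
    qed
    then have "(2::real) ^ ((\<kappa> n - j) * n + j * n) \<le> 2 ^ (j * m + \<kappa> n * n)"
      by (rule power_increasing) simp
    then show ?thesis by (simp add: wt_def power_add)
  qed
  then show ?thesis by (intro exI [of _ "2 ^ (j * m)"]) simp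
qed

lemma superexp_dominates:
  assumes "superexp \<kappa>"
  shows "\<exists>D\<ge>1. \<forall>n. 2 ^ (j * n) \<le> D * wt \<kappa> n"
proof -
  obtain D where D: "D \<ge> 1" "\<And>n. wt (\<lambda>n. \<kappa> n - j) n * 2 ^ (j * n) \<le> D * wt \<kappa> n"
    using superexp_absorb [OF assms, of j] by blast
  have "2 ^ (j * n) \<le> D * wt \<kappa> n" for n
  proof -
    have "1 * 2 ^ (j * n) \<le> wt (\<lambda>n. \<kappa> n - j) n * 2 ^ (j * n)"
      by (rule mult_right_mono [OF wt_ge1]) simp
    then show ?thesis using D(2) [of n] by linarith
  qed
  with D(1) show ?thesis by blast
qed

text \<open>The constants of a seminorm on the steps may grow arbitrarily fast with the step.
  Letting \<kappa> grow slowly enough keeps them below an exponential along \<kappa>.\<close>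

lemma superexp_below:
  fixes C :: "nat \<Rightarrow> real"
  shows "\<exists>\<kappa> D. superexp \<kappa> \<and> 1 \<le> D \<and> (\<forall>n. C (\<kappa> n) \<le> D * 2 ^ n)"
proof -
  \<comment> \<open>\<kappa> moves on to \<open>j\<close> only when \<open>2 ^ n\<close> exceeds all
    constants up to \<open>j\<close>. Index 0 is exempt, which keeps \<open>A n\<close> nonempty;
    \<open>C 0\<close> is paid for by the factor \<open>max 1 (C 0)\<close>.\<close>
  define A where "A n = {j. j \<le> n \<and> (\<forall>i. 1 \<le> i \<and> i \<le> j \<longrightarrow> C i \<le> 2 ^ n)}" for n
  define \<kappa> where "\<kappa> n = Max (A n)" for n
  have fin: "finite (A n)" for n
    by (simp add: A_def)
  have zero: "0 \<in> A n" for n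
    by (simp add: A_def)
  have in_A: "\<kappa> n \<in> A n" for n
    unfolding \<kappa>_def using fin zero by (intro Max_in) auto
  have A_mono: "A m \<subseteq> A n" if "m \<le> n" for m n
  proof -
    have "(2::real) ^ m \<le> 2 ^ n" using that by simp
    then have "C i \<le> 2 ^ n" if "C i \<le> 2 ^ m" for i using that by linarith
    with that show ?thesis by (auto simp: A_def)
  qed
  have "mono \<kappa>"
    unfolding \<kappa>_def using fin zero A_mono by (intro monoI Max_mono) blast+
  moreover have "\<exists>n. j \<le> \<kappa> n" for j
  proof -
    obtain m where m: "(\<Sum>i\<le>j. \<bar>C i\<bar>) < 2 ^ m"
      using real_arch_pow [of 2] by auto
    have "j \<in> A (max j m)"
      unfolding A_def
    proof (intro CollectI conjI allI impI)
      fix i assume "1 \<le> i \<and> i \<le> j"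
      then have "\<bar>C i\<bar> \<le> (\<Sum>i\<le>j. \<bar>C i\<bar>)"
        by (intro member_le_sum) auto
      moreover have "(2::real) ^ m \<le> 2 ^ max j m" by simp
      ultimately show "C i \<le> 2 ^ max j m" using m by linarith
    qed simp
    then show ?thesis unfolding \<kappa>_def using fin by (intro exI Max_ge)
  qed
  moreover have "C (\<kappa> n) \<le> max 1 (C 0) * 2 ^ n" for n
  proof (cases "\<kappa> n = 0")
    case True
    have "max 1 (C 0) * 1 \<le> max 1 (C 0) * 2 ^ n" by (intro mult_left_mono) auto
    then show ?thesis using True by simp
  next
    case False
    then have "C (\<kappa> n) \<le> 2 ^ n" using in_A [of n] by (auto simp: A_def)
    also have "1 * 2 ^ n \<le> max 1 (C 0) * 2 ^ n" by (intro mult_right_mono) auto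
    finally show ?thesis by simp
  qed
  ultimately show ?thesis
    unfolding superexp_def by (intro exI [of _ \<kappa>] exI [of _ "max 1 (C 0)"]) auto
qed

section \<open>Seminorms are controlled by their values on point masses\<close>

definition delta :: "rtree option \<Rightarrow> vfun" where
  "delta \<tau> = (\<lambda>\<sigma>. if \<sigma> = \<tau> then 1 else 0)"

definition cut_out :: "rtree option set \<Rightarrow> vfun \<Rightarrow> vfun" where
  "cut_out T a = (\<lambda>\<tau>. if \<tau> \<in> T then 0 else a \<tau>)"

text \<open>The source of the decay of \<open>p (delta \<tau>)\<close>: the norm of
  \<open>delta \<tau>\<close> in step \<open>k\<close> is at most
  \<open>(1/2) ^ (k * vsize \<tau>)\<close>, and \<open>k\<close> may be chosen depending on
  \<tau>.\<close>

lemma delta_bound: "cmod (delta \<tau> \<sigma>) \<le> (1/2) ^ (k * vsize \<tau>) * 2 ^ (k * vsize \<sigma>)"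
  by (simp add: delta_def power_one_over)

lemma delta_Ek: "delta \<tau> \<in> Ek k"
  unfolding Ek_iff using delta_bound by blast

lemma delta_Mspace: "delta \<tau> \<in> Mspace"
  using delta_Ek by (auto simp: Mspace_def)

lemma cut_out_Mspace:
  assumes "a \<in> Mspace"
  shows "cut_out T a \<in> Mspace"
proof -
  obtain k W where W: "\<And>\<tau>. cmod (a \<tau>) \<le> W * 2 ^ (k * vsize \<tau>)"
    using assms by (auto simp: Mspace_iff)
  have "cmod (cut_out T a \<tau>) \<le> W * 2 ^ (k * vsize \<tau>)" for \<tau>
    using W [of \<tau>] order_trans [OF norm_ge_zero W [of \<tau>]] by (simp add: cut_out_def)
  then show ?thesis unfolding Mspace_iff by blast
qed

lemma adm_seminorm_le_sum:
  assumes p: "adm_seminorm p" and a: "a \<in> Mspace" and "finite T"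
  shows "p a \<le> (\<Sum>\<tau>\<in>T. cmod (a \<tau>) * p (delta \<tau>)) + p (cut_out T a)"
  using \<open>finite T\<close>
proof (induction T rule: finite_induct)
  case empty
  show ?case by (simp add: cut_out_def)
next
  case (insert \<tau> T)
  have "cut_out T a = vadd (vsmul (a \<tau>) (delta \<tau>)) (cut_out (insert \<tau> T) a)"
    using insert.hyps(2) by (auto simp: vadd_def vsmul_def delta_def cut_out_def)
  then have "p (cut_out T a) \<le> cmod (a \<tau>) * p (delta \<tau>) + p (cut_out (insert \<tau> T) a)"
    using p a unfolding adm_seminorm_def
    by (metis Mspace_vsmul cut_out_Mspace delta_Mspace)
  then show ?case using insert by simp
qed

text \<open>The tails of \<open>a\<close> need not tend to 0 in the step \<open>Ek k\<close> of
  \<open>a\<close> itself. In the next step every coordinate beyond size \<open>N\<close> gains a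
  factor \<open>(1/2) ^ N\<close>.\<close>

lemma adm_seminorm_tail:
  assumes p: "adm_seminorm p" and a: "a \<in> Mspace"
  shows "(\<lambda>N. p (cut_out {\<tau>. vsize \<tau> \<le> N} a)) \<longlonglongrightarrow> 0"
proof -
  obtain k where k: "a \<in> Ek k"
    using a by (auto simp: Mspace_def)
  obtain C where C: "\<And>b. b \<in> Ek (Suc k) \<Longrightarrow> p b \<le> C * wnorm (Suc k) b"
    using p unfolding adm_seminorm_def by blast
  let ?r = "\<lambda>N. cut_out {\<tau>. vsize \<tau> \<le> N} a"
  have bd: "cmod (?r N \<tau>) \<le> (wnorm k a * (1/2) ^ N) * 2 ^ (Suc k * vsize \<tau>)" for N \<tau>
  proof (cases "vsize \<tau> \<le> N")
    case True
    then show ?thesis using wnorm_nonneg [OF k] by (simp add: cut_out_def)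
  next
    case False
    then have "(1::real) \<le> (1/2) ^ N * 2 ^ vsize \<tau>"
      by (simp add: divide_simps)
    then have "wnorm k a * 2 ^ (k * vsize \<tau>) * 1 \<le> wnorm k a * 2 ^ (k * vsize \<tau>) * ((1/2) ^ N * 2 ^ vsize \<tau>)"
      using wnorm_nonneg [OF k] by (intro mult_left_mono) auto
    then show ?thesis using wnorm_upper [OF k, of \<tau>] False
      by (simp add: cut_out_def power_add mult_ac)
  qed
  have r: "?r N \<in> Ek (Suc k)" for N
    unfolding Ek_iff using bd by blast
  have upper: "p (?r N) \<le> \<bar>C\<bar> * (wnorm k a * (1/2) ^ N)" for N
  proof -
    have "p (?r N) \<le> C * wnorm (Suc k) (?r N)"
      using C r by blast
    also have "\<dots> \<le> \<bar>C\<bar> * wnorm (Suc k) (?r N)"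
      using wnorm_nonneg [OF r] by (intro mult_right_mono) auto
    also have "\<dots> \<le> \<bar>C\<bar> * (wnorm k a * (1/2) ^ N)"
      using bd by (intro mult_left_mono wnorm_least) auto
    finally show ?thesis .
  qed
  have "(\<lambda>N. \<bar>C\<bar> * (wnorm k a * (1/2) ^ N)) \<longlonglongrightarrow> \<bar>C\<bar> * (wnorm k a * 0)"
    by (intro tendsto_mult tendsto_const LIMSEQ_power_zero) auto
  then have lim: "(\<lambda>N. \<bar>C\<bar> * (wnorm k a * (1/2) ^ N)) \<longlonglongrightarrow> 0"
    by simp
  show ?thesis
    by (rule tendsto_sandwich [OF _ _ tendsto_const lim])
      (use upper p a cut_out_Mspace in \<open>auto simp: adm_seminorm_def\<close>)
qed

lemma adm_seminorm_small:
  assumes p: "adm_seminorm p"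
  shows "\<exists>\<kappa> \<delta>. superexp \<kappa> \<and> 0 < \<delta> \<and>
    (\<forall>a\<in>Mspace. (\<forall>\<tau>. cmod (a \<tau>) \<le> \<delta> * wt \<kappa> (vsize \<tau>)) \<longrightarrow> p a < 1)"
proof -
  have "\<exists>C. \<forall>k. \<forall>a\<in>Ek k. p a \<le> C k * wnorm k a"
    using p unfolding adm_seminorm_def by (intro choice) blast
  then obtain C where C: "\<And>k a. a \<in> Ek k \<Longrightarrow> p a \<le> C k * wnorm k a"
    by blast
  \<comment> \<open>The shift by 4 yields a factor \<open>16 ^ n\<close>: \<open>2 ^ n\<close> is
    lost to the constants \<open>C\<close>, \<open>4 ^ n\<close> to the number of trees, and the
    last \<open>2 ^ n\<close> makes the series converge.\<close>
  obtain \<kappa> D where \<kappa>: "superexp \<kappa>" and D: "1 \<le> D" "\<And>n. \<bar>C (\<kappa> n + 4)\<bar> \<le> D * 2 ^ n"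
    using superexp_below [of "\<lambda>k. \<bar>C (k + 4)\<bar>"] by blast
  have p_delta: "p (delta \<tau>) * (8 ^ vsize \<tau> * wt \<kappa> (vsize \<tau>)) \<le> D" for \<tau>
  proof -
    let ?n = "vsize \<tau>" and ?k = "\<kappa> (vsize \<tau>) + 4"
    have "p (delta \<tau>) \<le> C ?k * wnorm ?k (delta \<tau>)"
      using C delta_Ek by blast
    also have "\<dots> \<le> \<bar>C ?k\<bar> * wnorm ?k (delta \<tau>)"
      using wnorm_nonneg [OF delta_Ek] by (intro mult_right_mono) auto
    also have "\<dots> \<le> (D * 2 ^ ?n) * (1/2) ^ (?k * ?n)"
      using D wnorm_nonneg [OF delta_Ek] wnorm_least [OF delta_bound] by (intro mult_mono) auto
    finally have "p (delta \<tau>) * (8 ^ ?n * wt \<kappa> ?n) \<le> (D * 2 ^ ?n) * (1/2) ^ (?k * ?n) * (8 ^ ?n * wt \<kappa> ?n)"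
      using wt_pos [of \<kappa> ?n] by (intro mult_right_mono) auto
    also have "(1/2 :: real) ^ (?k * ?n) = (1/2) ^ (\<kappa> ?n * ?n) * (1/16) ^ ?n"
      by (simp add: distrib_right power_add power_mult power_divide)
    also have "(D * 2 ^ ?n) * ((1/2) ^ (\<kappa> ?n * ?n) * (1/16) ^ ?n) * (8 ^ ?n * wt \<kappa> ?n)
        = D * ((2 * 8 * (1/16)) ^ ?n * ((1/2) ^ (\<kappa> ?n * ?n) * 2 ^ (\<kappa> ?n * ?n)))"
      by (simp only: wt_def power_mult_distrib mult_ac)
    also have "\<dots> = D"
      by (simp flip: power_mult_distrib)
    finally show ?thesis .
  qed
  \<comment> \<open>The series is then at most 1/4 times a geometric series with sum 2. The bound
    1/2 leaves room for the strict inequality, as the limit over \<open>N\<close> preserves only a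
    weak one.\<close>
  define \<delta> where "\<delta> = 1 / (4 * D)"
  have \<delta>: "0 < \<delta>" "\<delta> * D = 1/4"
    using D(1) by (simp_all add: \<delta>_def)
  have "p a < 1" if a: "a \<in> Mspace" and small: "\<And>\<tau>. cmod (a \<tau>) \<le> \<delta> * wt \<kappa> (vsize \<tau>)" for a
  proof -
    have summand: "cmod (a \<tau>) * p (delta \<tau>) \<le> (1/4) * (1/8) ^ vsize \<tau>" for \<tau>
    proof -
      have "cmod (a \<tau>) * p (delta \<tau>) \<le> \<delta> * wt \<kappa> (vsize \<tau>) * p (delta \<tau>)"
        using p delta_Mspace small by (intro mult_right_mono) (auto simp: adm_seminorm_def)
      also have "\<dots> = \<delta> * (p (delta \<tau>) * (8 ^ vsize \<tau> * wt \<kappa> (vsize \<tau>))) * (1/8) ^ vsize \<tau>"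
        by (simp add: power_one_over)
      also have "\<dots> \<le> \<delta> * D * (1/8) ^ vsize \<tau>"
        using p_delta \<delta>(1) by (intro mult_right_mono mult_left_mono) auto
      finally show ?thesis using \<delta>(2) by simp
    qed
    have fin: "finite {\<tau>. vsize \<tau> \<le> N}" for N
    proof -
      have "{\<tau>. vsize \<tau> \<le> N} = (\<Union>n\<le>N. {\<tau>. vsize \<tau> = n})" by auto
      then show ?thesis using finite_card_vsize by simp
    qed
    have sum_le: "(\<Sum>\<tau>\<in>{\<tau>. vsize \<tau> \<le> N}. cmod (a \<tau>) * p (delta \<tau>)) \<le> 1/2" for N
    proof -
      have "(\<Sum>\<tau>\<in>{\<tau>. vsize \<tau> \<le> N}. cmod (a \<tau>) * p (delta \<tau>))
          \<le> (\<Sum>\<tau>\<in>{\<tau>. vsize \<tau> \<le> N}. (1/4) * (1/8) ^ vsize \<tau>)"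
        by (intro sum_mono summand)
      also have "\<dots> = (\<Sum>n\<le>N. \<Sum>\<tau>\<in>{\<tau>. vsize \<tau> = n}. (1/4) * (1/8) ^ vsize \<tau>)"
      proof -
        have "{\<tau>. vsize \<tau> \<le> N} = (\<Union>n\<le>N. {\<tau>. vsize \<tau> = n})" by auto
        then show ?thesis
          using finite_card_vsize by (simp only:) (intro sum.UNION_disjoint, auto)
      qed
      also have "\<dots> \<le> (\<Sum>n\<le>N. (1/4) * (1/2) ^ n)"
      proof (rule sum_mono)
        fix n
        have "real (card {\<tau>. vsize \<tau> = n}) \<le> 4 ^ n"
          using finite_card_vsize [of n] by (metis of_nat_le_iff of_nat_numeral of_nat_power)
        then have "real (card {\<tau>. vsize \<tau> = n}) * ((1/4) * (1/8) ^ n) \<le> 4 ^ n * ((1/4) * (1/8) ^ n)"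
          by (intro mult_right_mono) auto
        also have "\<dots> = (1/4) * (4 * (1/8)) ^ n"
          by (simp only: power_mult_distrib mult_ac)
        finally show "(\<Sum>\<tau>\<in>{\<tau>. vsize \<tau> = n}. (1/4) * (1/8) ^ vsize \<tau>) \<le> (1/4) * (1/2 :: real) ^ n"
          by simp
      qed
      also have "\<dots> = (1/4) * (\<Sum>n\<le>N. (1/2) ^ n)"
        by (simp add: sum_distrib_left)
      also have "\<dots> \<le> 1/2"
        using zero_le_power [of "1/2 :: real" "Suc N"] unfolding sum_gp0 by (simp del: zero_le_power)
      finally show ?thesis .
    qed
    have "p a \<le> 1/2 + p (cut_out {\<tau>. vsize \<tau> \<le> N} a)" for N
      using adm_seminorm_le_sum [OF p a fin [of N]] sum_le [of N] by linarith
    then have "p a \<le> 1/2 + 0"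
      by (intro LIMSEQ_le_const [OF tendsto_add [OF tendsto_const adm_seminorm_tail [OF p a]]]) auto
    then show ?thesis by simp
  qed
  with \<kappa> \<delta>(1) show ?thesis by blast
qed

section \<open>The weights define admissible seminorms\<close>

definition wsup :: "(nat \<Rightarrow> nat) \<Rightarrow> vfun \<Rightarrow> real" where
  "wsup \<kappa> a = (SUP \<tau>. cmod (a \<tau>) / wt \<kappa> (vsize \<tau>))"

lemma wsup_bdd:
  assumes "superexp \<kappa>" "a \<in> Mspace"
  shows "bdd_above (range (\<lambda>\<tau>. cmod (a \<tau>) / wt \<kappa> (vsize \<tau>)))"
proof -
  obtain k where k: "a \<in> Ek k"
    using assms(2) by (auto simp: Mspace_def)
  obtain D where D: "\<And>n. 2 ^ (k * n) \<le> D * wt \<kappa> n"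
    using superexp_dominates [OF assms(1), of k] by blast
  have "cmod (a \<tau>) / wt \<kappa> (vsize \<tau>) \<le> wnorm k a * D" for \<tau>
  proof -
    have "cmod (a \<tau>) \<le> wnorm k a * (D * wt \<kappa> (vsize \<tau>))"
      using wnorm_upper [OF k, of \<tau>] D [of "vsize \<tau>"] wnorm_nonneg [OF k]
      by (meson mult_left_mono order_trans)
    then show ?thesis using wt_pos by (simp add: divide_simps mult_ac)
  qed
  then show ?thesis by (auto simp: bdd_above_def)
qed

lemma wsup_upper:
  assumes "superexp \<kappa>" "a \<in> Mspace"
  shows "cmod (a \<tau>) \<le> wsup \<kappa> a * wt \<kappa> (vsize \<tau>)"
  using cSUP_upper [OF _ wsup_bdd [OF assms], of \<tau>] wt_pos [of \<kappa> "vsize \<tau>"]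
  by (simp add: wsup_def divide_simps)

lemma wsup_least:
  assumes "\<And>\<tau>. cmod (a \<tau>) \<le> W * wt \<kappa> (vsize \<tau>)"
  shows "wsup \<kappa> a \<le> W"
  unfolding wsup_def using assms wt_pos by (intro cSUP_least) (auto simp: divide_simps mult_ac)

lemma wsup_nonneg: "superexp \<kappa> \<Longrightarrow> a \<in> Mspace \<Longrightarrow> 0 \<le> wsup \<kappa> a"
  using order_trans [OF norm_ge_zero wsup_upper [of \<kappa> a None]] by (simp add: wt_def)

lemma wsup_vsmul_le:
  assumes "superexp \<kappa>" "a \<in> Mspace"
  shows "wsup \<kappa> (vsmul c a) \<le> cmod c * wsup \<kappa> a"
proof (rule wsup_least)
  fix \<tau>
  show "cmod (vsmul c a \<tau>) \<le> cmod c * wsup \<kappa> a * wt \<kappa> (vsize \<tau>)"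
    using mult_left_mono [OF wsup_upper [OF assms, of \<tau>], of "cmod c"]
    by (simp add: vsmul_def norm_mult mult.assoc)
qed

text \<open>Hence the sets bounded by multiples of \<open>wt \<kappa>\<close> are zero
  neighbourhoods, while \<open>adm_seminorm_small\<close> says that they become arbitrarily small.
  The bound on \<open>Ek k\<close> holds because \<open>wt \<kappa>\<close> dominates
  \<open>2 ^ (k * n)\<close>.\<close>

lemma adm_seminorm_wsup:
  assumes \<kappa>: "superexp \<kappa>"
  shows "adm_seminorm (wsup \<kappa>)"
  unfolding adm_seminorm_def
proof (intro conjI ballI allI)
  fix a assume a: "a \<in> Mspace"
  show "0 \<le> wsup \<kappa> a"
    using wsup_nonneg [OF \<kappa> a] .
  show "wsup \<kappa> (vadd a b) \<le> wsup \<kappa> a + wsup \<kappa> b" if b: "b \<in> Mspace" for b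
    using norm_triangle_mono [OF wsup_upper [OF \<kappa> a] wsup_upper [OF \<kappa> b]]
    by (intro wsup_least) (simp add: vadd_def distrib_right)
  show "wsup \<kappa> (vsmul c a) = cmod c * wsup \<kappa> a" for c
  proof (cases "c = 0")
    case True
    then show ?thesis
      using wsup_vsmul_le [OF \<kappa> a, of c] wsup_nonneg [OF \<kappa> Mspace_vsmul [OF a, of c]] by simp
  next
    case False
    have "vsmul (inverse c) (vsmul c a) = a"
      using False by (simp add: vsmul_def fun_eq_iff)
    then have "wsup \<kappa> a \<le> inverse (cmod c) * wsup \<kappa> (vsmul c a)"
      using wsup_vsmul_le [OF \<kappa> Mspace_vsmul [OF a, of c], of "inverse c"] by (simp add: norm_inverse)
    then have "cmod c * wsup \<kappa> a \<le> wsup \<kappa> (vsmul c a)"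
      using False by (simp add: field_simps)
    then show ?thesis
      using wsup_vsmul_le [OF \<kappa> a, of c] by simp
  qed
next
  fix k
  obtain D where D: "\<And>n. 2 ^ (k * n) \<le> D * wt \<kappa> n"
    using superexp_dominates [OF \<kappa>, of k] by blast
  have "wsup \<kappa> a \<le> D * wnorm k a" if k: "a \<in> Ek k" for a
  proof (rule wsup_least)
    fix \<tau>
    show "cmod (a \<tau>) \<le> D * wnorm k a * wt \<kappa> (vsize \<tau>)"
      using wnorm_upper [OF k, of \<tau>] mult_left_mono [OF D [of "vsize \<tau>"] wnorm_nonneg [OF k]]
      by (simp add: mult_ac)
  qed
  then show "\<exists>C. \<forall>a\<in>Ek k. wsup \<kappa> a \<le> C * wnorm k a" by blast
qed

lemma adm_seminorm_scale:
  assumes "adm_seminorm p" "0 \<le> r"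
  shows "adm_seminorm (\<lambda>a. r * p a)"
  unfolding adm_seminorm_def
proof (intro conjI ballI allI)
  fix k
  obtain C where "\<And>a. a \<in> Ek k \<Longrightarrow> p a \<le> C * wnorm k a"
    using assms(1) unfolding adm_seminorm_def by blast
  then have "r * p a \<le> (r * C) * wnorm k a" if "a \<in> Ek k" for a
    using that assms(2) by (simp add: mult.assoc mult_left_mono)
  then show "\<exists>C. \<forall>a\<in>Ek k. r * p a \<le> C * wnorm k a" by blast
qed (use assms in \<open>auto simp: adm_seminorm_def mult_left_mono simp flip: distrib_left\<close>)

lemma adm_seminorm_add:
  assumes p: "adm_seminorm p" and q: "adm_seminorm q"
  shows "adm_seminorm (\<lambda>a. p a + q a)"
  unfolding adm_seminorm_def
proof (intro conjI ballI allI)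
  fix k
  obtain C D where "\<And>a. a \<in> Ek k \<Longrightarrow> p a \<le> C * wnorm k a" "\<And>a. a \<in> Ek k \<Longrightarrow> q a \<le> D * wnorm k a"
    using p q unfolding adm_seminorm_def by metis
  then have "p a + q a \<le> (C + D) * wnorm k a" if "a \<in> Ek k" for a
    using add_mono [of "p a" "C * wnorm k a" "q a" "D * wnorm k a"] that by (simp add: distrib_right)
  then show "\<exists>C. \<forall>a\<in>Ek k. p a + q a \<le> C * wnorm k a" by blast
next
  fix a b assume "a \<in> Mspace" "b \<in> Mspace"
  then have "p (vadd a b) \<le> p a + p b" "q (vadd a b) \<le> q a + q b"
    using p q unfolding adm_seminorm_def by blast+
  then show "p (vadd a b) + q (vadd a b) \<le> p a + q a + (p b + q b)" by linarith
qed (use p q in \<open>auto simp: adm_seminorm_def distrib_left\<close>)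

section \<open>Neighbourhoods in \<open>Mtop\<close>\<close>

lemma topspace_Mtop [simp]: "topspace Mtop = Mspace"
proof -
  have "adm_seminorm (\<lambda>a. 0)"
    by (auto simp: adm_seminorm_def intro: exI [of _ 0])
  then have "x \<in> \<Union> {{y\<in>Mspace. p (vsub y x) < 1} | p x. adm_seminorm p \<and> x \<in> Mspace}" if "x \<in> Mspace" for x
    using that by (intro UnionI [of "Mspace"]) force+
  then show ?thesis by (auto simp: Mtop_def)
qed

text \<open>The generating sets are balls about arbitrary centres. Intersections are handled by
  adding seminorms, and a ball is recentred at \<open>x\<close> by dividing its seminorm by the
  margin that \<open>x\<close> leaves.\<close>

lemma openin_Mtop_seminorm:
  assumes "openin Mtop U" "x \<in> U"
  shows "\<exists>p. adm_seminorm p \<and> (\<forall>y\<in>Mspace. p (vsub y x) < 1 \<longrightarrow> y \<in> U)"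
proof -
  let ?B = "{{y\<in>Mspace. p (vsub y x) < 1} | p x. adm_seminorm p \<and> x \<in> Mspace}"
  obtain T where T: "generate_topology_on ?B T" "U = T \<inter> Mspace"
    using assms(1) by (auto simp: Mtop_def openin_subtopology openin_topology_generated_by_iff)
  have "\<exists>p. adm_seminorm p \<and> (\<forall>y\<in>Mspace. p (vsub y x) < 1 \<longrightarrow> y \<in> T)" if "x \<in> T" "x \<in> Mspace"
    using T(1) that
  proof (induction arbitrary: x rule: generate_topology_on.induct)
    case (Int S T)
    have x: "x \<in> S" "x \<in> T" "x \<in> Mspace" using Int.prems by auto
    obtain p where p: "adm_seminorm p" "\<And>y. y \<in> Mspace \<Longrightarrow> p (vsub y x) < 1 \<Longrightarrow> y \<in> S"
      using Int.IH(1) [OF x(1,3)] by blast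
    obtain q where q: "adm_seminorm q" "\<And>y. y \<in> Mspace \<Longrightarrow> q (vsub y x) < 1 \<Longrightarrow> y \<in> T"
      using Int.IH(2) [OF x(2,3)] by blast
    have "y \<in> S \<inter> T" if y: "y \<in> Mspace" and "p (vsub y x) + q (vsub y x) < 1" for y
    proof -
      have "0 \<le> p (vsub y x)" "0 \<le> q (vsub y x)"
        using p(1) q(1) Mspace_vsub [OF y x(3)] unfolding adm_seminorm_def by blast+
      then show ?thesis using that p(2) [OF y] q(2) [OF y] by auto
    qed
    then show ?case using adm_seminorm_add [OF p(1) q(1)] by blast
  next
    case (UN K)
    then obtain S where S: "S \<in> K" "x \<in> S" by blast
    then show ?case using UN.IH [OF S UN.prems(2)] by blast
  next
    case (Basis S)
    then obtain p x0 where p: "adm_seminorm p" "x0 \<in> Mspace" and S: "S = {y \<in> Mspace. p (vsub y x0) < 1}"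
      by blast
    define \<epsilon> where "\<epsilon> = 1 - p (vsub x x0)"
    have \<epsilon>: "0 < \<epsilon>" using Basis S by (simp add: \<epsilon>_def)
    have "y \<in> S" if y: "y \<in> Mspace" and "inverse \<epsilon> * p (vsub y x) < 1" for y
    proof -
      have "p (vsub y x0) \<le> p (vsub y x) + p (vsub x x0)"
      proof -
        have "vsub y x0 = vadd (vsub y x) (vsub x x0)" by (simp add: vsub_def vadd_def)
        then show ?thesis using p y Basis Mspace_vsub unfolding adm_seminorm_def by metis
      qed
      moreover have "p (vsub y x) < \<epsilon>"
        using that(2) \<epsilon> by (simp add: field_simps)
      ultimately show ?thesis using y S by (simp add: \<epsilon>_def)
    qed
    then show ?case using adm_seminorm_scale [OF p(1), of "inverse \<epsilon>"] \<epsilon> by (metis inverse_nonnegative_iff_nonnegative less_imp_le)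
  qed auto
  moreover have "x \<in> Mspace" using assms(2) T by simp
  ultimately show ?thesis using assms(2) T by auto
qed

lemma openin_Mtop_nbhd:
  assumes "openin Mtop U" "x \<in> U"
  shows "\<exists>\<kappa> \<delta>. superexp \<kappa> \<and> 0 < \<delta> \<and>
    (\<forall>y\<in>Mspace. (\<forall>\<tau>. cmod (y \<tau> - x \<tau>) \<le> \<delta> * wt \<kappa> (vsize \<tau>)) \<longrightarrow> y \<in> U)"
proof -
  obtain p where p: "adm_seminorm p" "\<And>y. y \<in> Mspace \<Longrightarrow> p (vsub y x) < 1 \<Longrightarrow> y \<in> U"
    using openin_Mtop_seminorm [OF assms] by blast
  have "x \<in> Mspace"
    using assms openin_subset by fastforce
  obtain \<kappa> \<delta> where "superexp \<kappa>" "0 < \<delta>"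
    and small: "\<And>a. a \<in> Mspace \<Longrightarrow> (\<And>\<tau>. cmod (a \<tau>) \<le> \<delta> * wt \<kappa> (vsize \<tau>)) \<Longrightarrow> p a < 1"
    using adm_seminorm_small [OF p(1)] by blast
  moreover have "y \<in> U" if "y \<in> Mspace" "\<And>\<tau>. cmod (y \<tau> - x \<tau>) \<le> \<delta> * wt \<kappa> (vsize \<tau>)" for y
    using that small [OF Mspace_vsub [OF that(1) \<open>x \<in> Mspace\<close>]] p(2) by (simp add: vsub_def)
  ultimately show ?thesis by blast
qed

lemma Mtop_nbhd_openin:
  assumes "superexp \<kappa>" "0 < \<delta>" "x \<in> Mspace"
  shows "\<exists>U. openin Mtop U \<and> x \<in> U \<and> (\<forall>y\<in>U. \<forall>\<tau>. cmod (y \<tau> - x \<tau>) \<le> \<delta> * wt \<kappa> (vsize \<tau>))"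
proof (intro exI conjI ballI allI)
  let ?p = "\<lambda>a. inverse \<delta> * wsup \<kappa> a"
  let ?U = "{y\<in>Mspace. ?p (vsub y x) < 1}"
  have p: "adm_seminorm ?p"
    using adm_seminorm_scale [OF adm_seminorm_wsup [OF assms(1)], of "inverse \<delta>"] assms(2) by simp
  have "generate_topology_on {{y\<in>Mspace. p (vsub y x) < 1} | p x. adm_seminorm p \<and> x \<in> Mspace} ?U"
    using p assms(3) by (intro generate_topology_on.Basis CollectI exI [of _ ?p] exI [of _ x]) simp
  moreover have "?U = ?U \<inter> Mspace" by auto
  ultimately show "openin Mtop ?U"
    unfolding Mtop_def openin_subtopology openin_topology_generated_by_iff by blast
  have "wsup \<kappa> (vsub x x) \<le> 0"
    by (rule wsup_least) (simp add: vsub_def)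
  then have "?p (vsub x x) \<le> 0"
    using assms(2) by (simp add: mult_nonneg_nonpos)
  then show "x \<in> ?U"
    using assms(3) by simp
  fix y \<tau> assume y: "y \<in> ?U"
  then have "wsup \<kappa> (vsub y x) \<le> \<delta>"
    using assms(2) by (simp add: field_simps)
  then have "wsup \<kappa> (vsub y x) * wt \<kappa> (vsize \<tau>) \<le> \<delta> * wt \<kappa> (vsize \<tau>)"
    using wt_pos [of \<kappa> "vsize \<tau>"] by (intro mult_right_mono) auto
  then show "cmod (y \<tau> - x \<tau>) \<le> \<delta> * wt \<kappa> (vsize \<tau>)"
    using wsup_upper [OF assms(1) Mspace_vsub [of y x], of \<tau>] y assms(3) by (simp add: vsub_def)
qed

section \<open>Weighted homogeneous polynomials\<close>

text \<open>Polynomials of weighted degree \<open>n\<close> in the variables \<open>z v t\<close>, \<open>v \<in> V\<close>, of weight \<open>tsz t\<close>;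
  \<open>B\<close> bounds the sum of the absolute values of the coefficients.\<close>
inductive gpoly :: "'v set \<Rightarrow> nat \<Rightarrow> real \<Rightarrow> (('v \<Rightarrow> rtree \<Rightarrow> complex) \<Rightarrow> complex) \<Rightarrow> bool"
  for V where
  zero: "gpoly V n 0 (\<lambda>z. 0)"
| const: "gpoly V 0 (cmod c) (\<lambda>z. c)"
| var: "v \<in> V \<Longrightarrow> gpoly V (tsz t) 1 (\<lambda>z. z v t)"
| add: "gpoly V n B p \<Longrightarrow> gpoly V n C q \<Longrightarrow> gpoly V n (B + C) (\<lambda>z. p z + q z)"
| mult: "gpoly V n B p \<Longrightarrow> gpoly V m C q \<Longrightarrow> gpoly V (n + m) (B * C) (\<lambda>z. p z * q z)"
| mono: "gpoly V n B p \<Longrightarrow> B \<le> C \<Longrightarrow> gpoly V n C p"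

section \<open>Bounds for values, differences and first-order remainders\<close>

lemma gpoly_nonneg: "gpoly V n B p \<Longrightarrow> 0 \<le> B"
  by (induction rule: gpoly.induct) auto

lemma gpoly_subset: "gpoly V n B p \<Longrightarrow> V \<subseteq> W \<Longrightarrow> gpoly W n B p"
  by (induction rule: gpoly.induct) (auto intro: gpoly.intros)

lemma gpoly_sum_mset:
  assumes "\<And>x. x \<in># M \<Longrightarrow> gpoly V n 1 (P x)"
  shows "gpoly V n (size M) (\<lambda>z. \<Sum>x\<in>#M. P x z)"
  using assms
proof (induction M)
  case (add x M)
  have "gpoly V n (1 + real (size M)) (\<lambda>z. P x z + (\<Sum>x\<in>#M. P x z))"
    using add by (intro gpoly.add) auto
  then show ?case by simp
qed (simp add: gpoly.zero)

lemma gpoly_prod_mset: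
  assumes "v \<in> V"
  shows "gpoly V (\<Sum>t\<in>#F. tsz t) 1 (\<lambda>z. \<Prod>t\<in>#F. z v t)"
proof (induction F)
  case (add t F)
  show ?case
    using gpoly.mult [OF gpoly.var [OF assms] add] by simp
next
  case empty
  show ?case using gpoly.const [of V 1] by simp
qed

text \<open>What an induction over \<open>gpoly\<close> asks of a bound: \<open>ge1\<close> serves
  the constants, which have weight 0, and \<open>supermult\<close> the products. Instances are
  \<open>2 ^ (R * n)\<close> for values and derivatives and \<open>wt \<kappa>\<close> for
  continuity.\<close>

locale growth =
  fixes S :: "nat \<Rightarrow> real"
  assumes ge1: "1 \<le> S n" and supermult: "S n * S m \<le> S (n + m)"
begin

lemma nonneg: "0 \<le> S n"
  using ge1 [of n] by linarith

lemma gpoly_bound: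
  assumes "gpoly V n B p" and "\<And>v t. v \<in> V \<Longrightarrow> cmod (z v t) \<le> S (tsz t)"
  shows "cmod (p z) \<le> B * S n"
  using assms(1)
proof (induction rule: gpoly.induct)
  case (const c)
  show ?case using ge1 [of 0] mult_left_mono [of 1 "S 0" "cmod c"] by simp
next
  case (add n B p C q)
  then show ?case
    using norm_triangle_ineq [of "p z" "q z"] by (simp add: distrib_right)
next
  case (mult n B p m C q)
  have "cmod (p z) * cmod (q z) \<le> (B * S n) * (C * S m)"
    using mult gpoly_nonneg [OF mult.hyps(1)] nonneg by (intro mult_mono) auto
  also have "\<dots> = (B * C) * (S n * S m)" by simp
  also have "\<dots> \<le> (B * C) * S (n + m)"
    using mult.hyps supermult by (intro mult_left_mono) (auto dest!: gpoly_nonneg)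
  finally show ?case by (simp add: norm_mult)
next
  case (mono n B p C)
  then show ?case using nonneg by (meson mult_right_mono order_trans)
qed (use assms(2) in auto)

text \<open>Every variable has weight at least 1, so a monomial of weight \<open>n\<close> has at
  most \<open>n\<close> factors. Exchanging them one at a time costs \<delta> for each, hence the
  factor \<open>n\<close>.\<close>

lemma gpoly_diff:
  assumes "gpoly V n B p" and "0 \<le> \<delta>"
    and z: "\<And>v t. v \<in> V \<Longrightarrow> cmod (z v t) \<le> S (tsz t)"
    and z': "\<And>v t. v \<in> V \<Longrightarrow> cmod (z' v t) \<le> S (tsz t)"
    and d: "\<And>v t. v \<in> V \<Longrightarrow> cmod (z' v t - z v t) \<le> \<delta> * S (tsz t)"
  shows "cmod (p z' - p z) \<le> \<delta> * (n * B) * S n"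
  using assms(1)
proof (induction rule: gpoly.induct)
  case (var v t)
  have "1 \<le> real (tsz t)"
    using tsz_pos [of t] by linarith
  then have "\<delta> * 1 * S (tsz t) \<le> \<delta> * tsz t * S (tsz t)"
    using \<open>0 \<le> \<delta>\<close> nonneg by (intro mult_right_mono mult_left_mono) auto
  then show ?case using d [OF var, of t] by simp
next
  case (add n B p C q)
  have "p z' + q z' - (p z + q z) = (p z' - p z) + (q z' - q z)" by simp
  then have "cmod (p z' + q z' - (p z + q z)) \<le> cmod (p z' - p z) + cmod (q z' - q z)"
    by (metis norm_triangle_ineq)
  also have "\<dots> \<le> \<delta> * (n * B) * S n + \<delta> * (n * C) * S n"
    using add by linarith
  finally show ?case by (simp add: algebra_simps)
next
  case (mult n B p m C q)
  note B = gpoly_nonneg [OF mult.hyps(1)] and C = gpoly_nonneg [OF mult.hyps(2)]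
  have "p z' * q z' - p z * q z = (p z' - p z) * q z' + p z * (q z' - q z)"
    by (simp add: algebra_simps)
  then have "cmod (p z' * q z' - p z * q z) \<le> cmod (p z' - p z) * cmod (q z') + cmod (p z) * cmod (q z' - q z)"
    by (metis norm_triangle_ineq norm_mult)
  also have "\<dots> \<le> (\<delta> * (n * B) * S n) * (C * S m) + (B * S n) * (\<delta> * (m * C) * S m)"
    using mult.IH gpoly_bound [OF mult.hyps(1)] gpoly_bound [OF mult.hyps(2)] z z' B C nonneg \<open>0 \<le> \<delta>\<close>
    by (intro add_mono mult_mono) auto
  also have "\<dots> = \<delta> * ((n + m) * (B * C)) * (S n * S m)"
    by (simp add: algebra_simps)
  also have "\<dots> \<le> \<delta> * ((n + m) * (B * C)) * S (n + m)"
    using B C \<open>0 \<le> \<delta>\<close> supermult by (intro mult_left_mono) auto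
  finally show ?case by simp
next
  case (mono n B p C)
  have "\<delta> * (n * B) * S n \<le> \<delta> * (n * C) * S n"
    using mono.hyps nonneg \<open>0 \<le> \<delta>\<close> by (intro mult_left_mono mult_right_mono) auto
  then show ?case using mono.IH by linarith
qed auto

end

text \<open>\<open>\<sigma> v\<close> is the variable that holds the direction in which
  \<open>v\<close> moves; \<open>None\<close> means that \<open>v\<close> stays fixed.\<close>

definition shift :: "('v \<Rightarrow> 'v option) \<Rightarrow> complex \<Rightarrow> ('v \<Rightarrow> rtree \<Rightarrow> complex) \<Rightarrow> 'v \<Rightarrow> rtree \<Rightarrow> complex" where
  "shift \<sigma> s z v t = z v t + s * (case \<sigma> v of None \<Rightarrow> 0 | Some u \<Rightarrow> z u t)"

text \<open>First-order Taylor expansion by the product rule. The polynomial \<open>p'\<close> is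
  fixed before \<open>S\<close>, \<open>s\<close> and \<open>z\<close>, so one derivative serves all
  points. The constant \<open>n\<^sup>2\<close> survives products because
  \<open>n\<^sup>2 + m\<^sup>2 + n * m \<le> (n + m)\<^sup>2\<close>.\<close>

lemma gpoly_deriv:
  assumes "gpoly V n B p" and "V \<subseteq> W" and "\<And>v u. v \<in> V \<Longrightarrow> \<sigma> v = Some u \<Longrightarrow> u \<in> W"
  shows "\<exists>p'. gpoly W n (n * B) p' \<and>
    (\<forall>S s z. growth S \<and> (\<forall>v\<in>W. \<forall>t. cmod (z v t) \<le> S (tsz t))
       \<and> (\<forall>v\<in>V. \<forall>t. cmod (shift \<sigma> s z v t) \<le> S (tsz t))
      \<longrightarrow> cmod (p (shift \<sigma> s z) - p z - s * p' z) \<le> (cmod s)\<^sup>2 * ((real n)\<^sup>2 * B) * S n)"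
    (is "\<exists>p'. _ \<and> (\<forall>S s z. ?good S s z \<longrightarrow> _)")
  using assms(1)
proof (induction rule: gpoly.induct)
  case (zero n)
  show ?case by (intro exI [of _ "\<lambda>z. 0"]) (auto intro: gpoly.zero)
next
  case (const c)
  show ?case by (intro exI [of _ "\<lambda>z. 0"]) (auto intro: gpoly.zero)
next
  case (var v t)
  have t: "1 \<le> real (tsz t)"
    using tsz_pos [of t] by linarith
  define p' where "p' z = (case \<sigma> v of None \<Rightarrow> 0 | Some u \<Rightarrow> z u t)" for z :: "'a \<Rightarrow> rtree \<Rightarrow> complex"
  have "gpoly W (tsz t) (real (tsz t) * 1) p'"
  proof (cases "\<sigma> v")
    case None
    then have "p' = (\<lambda>z. 0)" by (simp add: p'_def fun_eq_iff)
    then show ?thesis by (auto intro: gpoly.mono gpoly.zero)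
  next
    case (Some u)
    then have "p' = (\<lambda>z. z u t)" by (simp add: p'_def fun_eq_iff)
    then show ?thesis using t assms(3) [OF var Some] by (auto intro: gpoly.mono gpoly.var)
  qed
  moreover have "cmod (shift \<sigma> s z v t - z v t - s * p' z) \<le> (cmod s)\<^sup>2 * ((real (tsz t))\<^sup>2 * 1) * S (tsz t)"
    if "growth S" for S s z
    using growth.nonneg [OF that] by (simp add: shift_def p'_def)
  ultimately show ?case by blast
next
  case (add n B p C q)
  from add.IH obtain p' q' where p': "gpoly W n (n * B) p'" and q': "gpoly W n (n * C) q'"
    and rp: "\<And>S s z. ?good S s z \<Longrightarrow> cmod (p (shift \<sigma> s z) - p z - s * p' z) \<le> (cmod s)\<^sup>2 * ((real n)\<^sup>2 * B) * S n"
    and rq: "\<And>S s z. ?good S s z \<Longrightarrow> cmod (q (shift \<sigma> s z) - q z - s * q' z) \<le> (cmod s)\<^sup>2 * ((real n)\<^sup>2 * C) * S n"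
    by blast
  have "cmod (p (shift \<sigma> s z) + q (shift \<sigma> s z) - (p z + q z) - s * (p' z + q' z))
      \<le> (cmod s)\<^sup>2 * ((real n)\<^sup>2 * (B + C)) * S n" if "?good S s z" for S s z
  proof -
    have "p (shift \<sigma> s z) + q (shift \<sigma> s z) - (p z + q z) - s * (p' z + q' z)
        = (p (shift \<sigma> s z) - p z - s * p' z) + (q (shift \<sigma> s z) - q z - s * q' z)"
      by (simp add: algebra_simps)
    then have "cmod (p (shift \<sigma> s z) + q (shift \<sigma> s z) - (p z + q z) - s * (p' z + q' z))
        \<le> (cmod s)\<^sup>2 * ((real n)\<^sup>2 * B) * S n + (cmod s)\<^sup>2 * ((real n)\<^sup>2 * C) * S n"
      using norm_triangle_ineq rp [OF that] rq [OF that] by (smt (verit))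
    then show ?thesis by (simp add: algebra_simps)
  qed
  moreover have "gpoly W n (n * (B + C)) (\<lambda>z. p' z + q' z)"
    using gpoly.add [OF p' q'] by (simp add: algebra_simps)
  ultimately show ?case by blast
next
  case (mult n B p m C q)
  from mult.IH obtain p' q' where p': "gpoly W n (n * B) p'" and q': "gpoly W m (m * C) q'"
    and rp: "\<And>S s z. ?good S s z \<Longrightarrow> cmod (p (shift \<sigma> s z) - p z - s * p' z) \<le> (cmod s)\<^sup>2 * ((real n)\<^sup>2 * B) * S n"
    and rq: "\<And>S s z. ?good S s z \<Longrightarrow> cmod (q (shift \<sigma> s z) - q z - s * q' z) \<le> (cmod s)\<^sup>2 * ((real m)\<^sup>2 * C) * S m"
    by blast
  note B = gpoly_nonneg [OF mult.hyps(1)] and C = gpoly_nonneg [OF mult.hyps(2)]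
  have pW: "gpoly W n B p" and qW: "gpoly W m C q"
    using mult.hyps assms(2) by (auto intro: gpoly_subset)
  have "cmod (p (shift \<sigma> s z) * q (shift \<sigma> s z) - p z * q z - s * (p' z * q z + p z * q' z))
      \<le> (cmod s)\<^sup>2 * ((real (n + m))\<^sup>2 * (B * C)) * S (n + m)" if good: "?good S s z" for S s z
  proof -
    interpret growth S using good by blast
    let ?P = "p (shift \<sigma> s z)" and ?Q = "q (shift \<sigma> s z)"
    have Q: "cmod ?Q \<le> C * S m"
      using good by (intro gpoly_bound [OF mult.hyps(2)]) auto
    have pz: "cmod (p z) \<le> B * S n"
      using good by (intro gpoly_bound [OF pW]) auto
    have p'z: "cmod (p' z) \<le> n * B * S n"
      using good by (intro gpoly_bound [OF p']) auto
    have dQ: "cmod (?Q - q z) \<le> cmod s * (m * C) * S m"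
    proof (rule gpoly_diff [OF mult.hyps(2)])
      fix v t assume v: "v \<in> V"
      have "cmod (case \<sigma> v of None \<Rightarrow> 0 | Some u \<Rightarrow> z u t) \<le> S (tsz t)"
        using good assms(3) [OF v] nonneg by (auto split: option.splits)
      then show "cmod (shift \<sigma> s z v t - z v t) \<le> cmod s * S (tsz t)"
        by (simp add: shift_def norm_mult mult_left_mono)
    qed (use good assms(2) in auto)
    \<comment> \<open>The first two terms carry the remainders of the factors; in the third,
      \<open>gpoly_diff\<close> supplies the second factor of \<open>s\<close>.\<close>
    have "?P * ?Q - p z * q z - s * (p' z * q z + p z * q' z)
       = (?P - p z - s * p' z) * ?Q + p z * (?Q - q z - s * q' z) + s * (p' z * (?Q - q z))"
      by (simp add: algebra_simps)
    then have "cmod (?P * ?Q - p z * q z - s * (p' z * q z + p z * q' z))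
       \<le> cmod (?P - p z - s * p' z) * cmod ?Q + cmod (p z) * cmod (?Q - q z - s * q' z)
         + cmod s * (cmod (p' z) * cmod (?Q - q z))"
      by (metis (no_types, lifting) norm_mult norm_triangle_mono norm_triangle_ineq order_refl)
    also have "\<dots> \<le> ((cmod s)\<^sup>2 * ((real n)\<^sup>2 * B) * S n) * (C * S m)
         + (B * S n) * ((cmod s)\<^sup>2 * ((real m)\<^sup>2 * C) * S m)
         + cmod s * ((n * B * S n) * (cmod s * (m * C) * S m))"
      using rp [OF good] rq [OF good] Q pz p'z dQ B C nonneg
      by (intro add_mono mult_mono mult_left_mono) auto
    also have "\<dots> = (cmod s)\<^sup>2 * (((real n)\<^sup>2 + (real m)\<^sup>2 + n * m) * (B * C)) * (S n * S m)"
      by (simp add: algebra_simps power2_eq_square)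
    also have "\<dots> \<le> (cmod s)\<^sup>2 * ((real (n + m))\<^sup>2 * (B * C)) * S (n + m)"
      using B C nonneg supermult
      by (intro mult_mono mult_left_mono mult_right_mono) (auto simp: power2_sum)
    finally show ?thesis .
  qed
  moreover have "gpoly W (n + m) ((n + m) * (B * C)) (\<lambda>z. p' z * q z + p z * q' z)"
    using gpoly.add [OF gpoly.mult [OF p' qW] gpoly.mult [OF pW q']] by (simp add: algebra_simps)
  ultimately show ?case by blast
next
  case (mono n B p C)
  from mono.IH obtain p' where p': "gpoly W n (n * B) p'"
    and rp: "\<And>S s z. ?good S s z \<Longrightarrow> cmod (p (shift \<sigma> s z) - p z - s * p' z) \<le> (cmod s)\<^sup>2 * ((real n)\<^sup>2 * B) * S n"
    by blast
  show ?case
  proof (intro exI conjI allI impI)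
    show "gpoly W n (n * C) p'"
      using mono.hyps(2) by (intro gpoly.mono [OF p'] mult_left_mono) auto
  next
    fix S s z assume good: "?good S s z"
    have "(cmod s)\<^sup>2 * ((real n)\<^sup>2 * B) * S n \<le> (cmod s)\<^sup>2 * ((real n)\<^sup>2 * C) * S n"
      using mono.hyps growth.nonneg good by (intro mult_right_mono mult_left_mono) auto
    then show "cmod (p (shift \<sigma> s z) - p z - s * p' z) \<le> (cmod s)\<^sup>2 * ((real n)\<^sup>2 * C) * S n"
      using rp [OF good] by linarith
  qed
qed

section \<open>Smoothness\<close>

lemma MstarI:
  assumes "x None = 0" "\<And>t. cmod (x (Some t)) \<le> W * 2 ^ (k * tsz t)"
  shows "x \<in> Mstar"
proof -
  have "cmod (x \<tau>) \<le> \<bar>W\<bar> * 2 ^ (k * vsize \<tau>)" for \<tau>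
  proof (cases \<tau>)
    case (Some t)
    have "W * 2 ^ (k * tsz t) \<le> \<bar>W\<bar> * 2 ^ (k * tsz t)"
      by (intro mult_right_mono) auto
    from order_trans [OF assms(2) this] show ?thesis using Some by simp
  qed (simp add: assms(1))
  then show ?thesis
    unfolding Mstar_def Mspace_iff using assms(1) by blast
qed

text \<open>The constant moves into the base because \<open>tsz t \<ge> 1\<close>. It has to, since
  \<open>W * 2 ^ (k * n)\<close> with \<open>W > 1\<close> is not supermultiplicative.\<close>

lemma Mstar_bound:
  assumes "x \<in> Mstar"
  shows "\<exists>R. \<forall>t. cmod (x (Some t)) \<le> 2 ^ (R * tsz t)"
proof -
  obtain k W where W: "\<And>\<tau>. cmod (x \<tau>) \<le> W * 2 ^ (k * vsize \<tau>)"
    using assms by (auto simp: Mstar_def Mspace_iff)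
  obtain m where m: "W < 2 ^ m"
    using real_arch_pow [of 2] by auto
  have "cmod (x (Some t)) \<le> 2 ^ ((m + k) * tsz t)" for t
  proof -
    have "(2::real) ^ m \<le> 2 ^ (m * tsz t)"
      using tsz_pos [of t] by (intro power_increasing) auto
    with m have "W \<le> 2 ^ (m * tsz t)" by linarith
    then have "W * 2 ^ (k * tsz t) \<le> 2 ^ (m * tsz t) * 2 ^ (k * tsz t)"
      by (rule mult_right_mono) simp
    moreover have "cmod (x (Some t)) \<le> W * 2 ^ (k * tsz t)"
      using W [of "Some t"] by simp
    ultimately have "cmod (x (Some t)) \<le> 2 ^ (m * tsz t) * 2 ^ (k * tsz t)"
      by (rule order_trans [rotated])
    then show ?thesis by (simp add: power_add distrib_right)
  qed
  then show ?thesis by blast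
qed

lemma Mstar_subset_Mspace: "Mstar \<subseteq> Mspace"
  by (auto simp: Mstar_def)

lemma Mstar_vadd: "a \<in> Mstar \<Longrightarrow> b \<in> Mstar \<Longrightarrow> vadd a b \<in> Mstar"
  by (auto simp: Mstar_def Mspace_vadd) (simp add: vadd_def)

lemma Mstar_vsmul: "a \<in> Mstar \<Longrightarrow> vsmul c a \<in> Mstar"
  by (auto simp: Mstar_def Mspace_vsmul) (simp add: vsmul_def)

lemma MstarS_simps [simp]:
  "lc_carrier MstarS = Mstar" "lc_add MstarS = vadd" "lc_smul MstarS = vsmul"
  "lc_top MstarS = subtopology Mtop Mstar" "lc_sub MstarS = vsub"
  by (simp_all add: MstarS_def lc_sub_def vsub_eq fun_eq_iff)

lemma topspace_Mstar [simp]: "topspace (subtopology Mtop Mstar) = Mstar"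
  using Mstar_subset_Mspace by auto

lemma Mstar_nbhd_openin:
  assumes "superexp \<kappa>" "0 < \<delta>" "x \<in> Mstar"
  shows "\<exists>U. openin (subtopology Mtop Mstar) U \<and> x \<in> U \<and>
    (\<forall>y\<in>U. \<forall>\<tau>. cmod (y \<tau> - x \<tau>) \<le> \<delta> * wt \<kappa> (vsize \<tau>))"
proof -
  obtain U where U: "openin Mtop U" "x \<in> U"
      "\<forall>y\<in>U. \<forall>\<tau>. cmod (y \<tau> - x \<tau>) \<le> \<delta> * wt \<kappa> (vsize \<tau>)"
    using Mtop_nbhd_openin [OF assms(1,2)] assms(3) Mstar_subset_Mspace by blast
  then show ?thesis
    using assms(3) by (intro exI [of _ "U \<inter> Mstar"]) (auto simp: openin_subtopology)
qed

lemma openin_Mstar_nbhd: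
  assumes "openin (subtopology Mtop Mstar) U" "x \<in> U"
  shows "\<exists>\<kappa> \<delta>. superexp \<kappa> \<and> 0 < \<delta> \<and>
    (\<forall>y\<in>Mstar. (\<forall>\<tau>. cmod (y \<tau> - x \<tau>) \<le> \<delta> * wt \<kappa> (vsize \<tau>)) \<longrightarrow> y \<in> U)"
proof -
  obtain T where T: "openin Mtop T" "U = T \<inter> Mstar"
    using assms(1) by (auto simp: openin_subtopology)
  then obtain \<kappa> \<delta> where "superexp \<kappa>" "0 < \<delta>"
      "\<forall>y\<in>Mspace. (\<forall>\<tau>. cmod (y \<tau> - x \<tau>) \<le> \<delta> * wt \<kappa> (vsize \<tau>)) \<longrightarrow> y \<in> T"
    using openin_Mtop_nbhd [OF T(1), of x] assms(2) by blast
  then show ?thesis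
    using T(2) Mstar_subset_Mspace by (intro exI [of _ \<kappa>] exI [of _ \<delta>]) auto
qed

lemma superexp_id: "superexp (\<lambda>n. n)"
  by (auto simp: superexp_def mono_def)

text \<open>Justifies the \<open>THE\<close> in \<open>ddiff\<close>: neighbourhoods bound each
  coordinate, so distinct limits are separated at some tree.\<close>

lemma lc_lim_MstarS_unique:
  assumes "lc_lim MstarS g L" "lc_lim MstarS g L'"
  shows "L = L'"
proof (rule ccontr)
  assume "L \<noteq> L'"
  then obtain \<tau> where \<tau>: "L \<tau> \<noteq> L' \<tau>" by blast
  \<comment> \<open>A third of the gap, so that two errors together stay below it.\<close>
  define \<delta> where "\<delta> = cmod (L \<tau> - L' \<tau>) / (3 * wt (\<lambda>n. n) (vsize \<tau>))"
  have \<delta>: "0 < \<delta>" "3 * (\<delta> * wt (\<lambda>n. n) (vsize \<tau>)) = cmod (L \<tau> - L' \<tau>)"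
    using \<tau> wt_pos [of "\<lambda>n. n" "vsize \<tau>"] by (simp_all add: \<delta>_def)
  have near: "\<forall>\<^sub>F t in at 0. cmod (g t \<tau> - M \<tau>) \<le> \<delta> * wt (\<lambda>n. n) (vsize \<tau>)"
    if M: "lc_lim MstarS g M" for M
  proof -
    have "M \<in> Mstar" using M by (simp add: lc_lim_def Mstar_subset_Mspace)
    then obtain U where U: "openin (subtopology Mtop Mstar) U" "M \<in> U"
        "\<forall>y\<in>U. \<forall>\<tau>. cmod (y \<tau> - M \<tau>) \<le> \<delta> * wt (\<lambda>n. n) (vsize \<tau>)"
      using Mstar_nbhd_openin [OF superexp_id \<delta>(1)] by blast
    then have "\<forall>\<^sub>F t in at 0. g t \<in> U"
      using M by (simp add: lc_lim_def)
    then show ?thesis by eventually_elim (use U(3) in blast)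
  qed
  have "\<forall>\<^sub>F t in at (0::complex). cmod (L \<tau> - L' \<tau>) \<le> 2 * (\<delta> * wt (\<lambda>n. n) (vsize \<tau>))"
    using near [OF assms(1)] near [OF assms(2)]
  proof eventually_elim
    case (elim t)
    have "cmod (L \<tau> - L' \<tau>) \<le> cmod (g t \<tau> - L \<tau>) + cmod (g t \<tau> - L' \<tau>)"
      by (metis norm_minus_commute norm_triangle_ineq4 diff_diff_eq2 diff_add_cancel)
    then show ?case using elim by linarith
  qed
  then have "cmod (L \<tau> - L' \<tau>) \<le> 2 * (\<delta> * wt (\<lambda>n. n) (vsize \<tau>))"
    by simp
  moreover have "0 < \<delta> * wt (\<lambda>n. n) (vsize \<tau>)"
    using \<delta>(1) wt_pos by (rule mult_pos_pos)
  ultimately show False using \<delta>(2) by linarith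
qed

text \<open>Convergence at a linear rate within one step implies convergence in every neighbourhood,
  as every \<open>wt \<kappa>\<close> dominates \<open>2 ^ (j * n)\<close> up to a constant.\<close>

lemma lc_lim_MstarSI:
  assumes "\<And>s. g s \<in> Mstar" "L \<in> Mstar"
    and "\<And>s \<tau>. s \<noteq> 0 \<Longrightarrow> cmod s \<le> 1 \<Longrightarrow> cmod (g s \<tau> - L \<tau>) \<le> cmod s * 2 ^ (j * vsize \<tau>)"
  shows "lc_lim MstarS g L"
  unfolding lc_lim_def
proof (intro conjI allI impI)
  show "L \<in> topspace (lc_top MstarS)"
    using assms(2) by (simp add: Mstar_subset_Mspace [THEN subsetD])
next
  fix V assume V: "openin (lc_top MstarS) V \<and> L \<in> V"
  then obtain \<kappa> \<delta> where \<kappa>: "superexp \<kappa>" "0 < \<delta>"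
      and sub: "\<And>y. y \<in> Mstar \<Longrightarrow> (\<And>\<tau>. cmod (y \<tau> - L \<tau>) \<le> \<delta> * wt \<kappa> (vsize \<tau>)) \<Longrightarrow> y \<in> V"
    using openin_Mstar_nbhd [of V L] by auto
  obtain D where D: "1 \<le> D" "\<And>n. 2 ^ (j * n) \<le> D * wt \<kappa> n"
    using superexp_dominates [OF \<kappa>(1), of j] by blast
  have "\<forall>\<^sub>F s in at (0::complex). s \<noteq> 0 \<and> cmod s < min 1 (\<delta> / D)"
    unfolding eventually_at using \<kappa>(2) D(1)
    by (intro exI [of _ "min 1 (\<delta> / D)"]) (auto simp: dist_norm)
  then show "\<forall>\<^sub>F s in at 0. g s \<in> V"
  proof eventually_elim
    case (elim s)
    show ?case
    proof (rule sub [OF assms(1)])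
      fix \<tau>
      have "cmod (g s \<tau> - L \<tau>) \<le> cmod s * 2 ^ (j * vsize \<tau>)"
        using elim by (intro assms(3)) auto
      also have "\<dots> \<le> (\<delta> / D) * (D * wt \<kappa> (vsize \<tau>))"
        using elim D \<kappa>(2) by (intro mult_mono) auto
      also have "\<dots> = \<delta> * wt \<kappa> (vsize \<tau>)"
        using D(1) by simp
      finally show "cmod (g s \<tau> - L \<tau>) \<le> \<delta> * wt \<kappa> (vsize \<tau>)" .
    qed
  qed
qed

lemma growth_wt: "mono \<kappa> \<Longrightarrow> growth (wt \<kappa>)"
proof
  fix n m :: nat
  assume "mono \<kappa>"
  then have "\<kappa> n * n + \<kappa> m * m \<le> \<kappa> (n + m) * n + \<kappa> (n + m) * m"
    by (intro add_mono mult_le_mono1) (auto intro: monoD)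
  then have "(2::real) ^ (\<kappa> n * n + \<kappa> m * m) \<le> 2 ^ (\<kappa> (n + m) * (n + m))"
    by (intro power_increasing) (auto simp: distrib_left)
  then show "wt \<kappa> n * wt \<kappa> m \<le> wt \<kappa> (n + m)"
    by (simp add: wt_def power_add)
qed (rule wt_ge1)

lemma growth_power: "growth (\<lambda>n. 2 ^ (R * n))"
  using growth_wt [of "\<lambda>_. R"] by (simp add: wt_def [abs_def] mono_def)

lemma of_nat_le_two_power: "real n \<le> 2 ^ n"
  using less_exp [of n] by (metis less_imp_le of_nat_le_iff of_nat_numeral of_nat_power)

text \<open>Treats \<open>Mstar\<close> and \<open>Mstar \<times> Mstar\<close> at once: the coordinates \<open>co True\<close> and \<open>co False\<close> are the two
  components in the latter and coincide in the former.\<close>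
locale coord_space =
  fixes E :: "'s lcs" and co :: "bool \<Rightarrow> 's \<Rightarrow> vfun"
  assumes co_Mstar: "x \<in> lc_carrier E \<Longrightarrow> co b x \<in> Mstar"
    and add_closed: "x \<in> lc_carrier E \<Longrightarrow> y \<in> lc_carrier E \<Longrightarrow> lc_add E x y \<in> lc_carrier E"
    and smul_closed: "x \<in> lc_carrier E \<Longrightarrow> lc_smul E c x \<in> lc_carrier E"
    and co_add: "x \<in> lc_carrier E \<Longrightarrow> y \<in> lc_carrier E \<Longrightarrow> co b (lc_add E x y) = vadd (co b x) (co b y)"
    and co_smul: "x \<in> lc_carrier E \<Longrightarrow> co b (lc_smul E c x) = vsmul c (co b x)"
    and topspace_E: "topspace (lc_top E) = lc_carrier E"
    and co_nbhd: "superexp \<kappa> \<Longrightarrow> 0 < \<delta> \<Longrightarrow> x \<in> lc_carrier E \<Longrightarrow>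
      \<exists>U. openin (lc_top E) U \<and> x \<in> U \<and> (\<forall>y\<in>U. \<forall>b \<tau>. cmod (co b y \<tau> - co b x \<tau>) \<le> \<delta> * wt \<kappa> (vsize \<tau>))"
begin

text \<open>The variables \<open>(b, 0)\<close> belong to the point \<open>x\<close>, the variables \<open>(b, Suc j)\<close> to the direction \<open>hs j\<close>.\<close>
definition coords :: "'s \<Rightarrow> (nat \<Rightarrow> 's) \<Rightarrow> bool \<times> nat \<Rightarrow> rtree \<Rightarrow> complex" where
  "coords x hs = (\<lambda>(b, i) t. co b (case i of 0 \<Rightarrow> x | Suc j \<Rightarrow> hs j) (Some t))"

definition poly_map :: "nat \<Rightarrow> nat \<Rightarrow> (rtree \<Rightarrow> (bool \<times> nat \<Rightarrow> rtree \<Rightarrow> complex) \<Rightarrow> complex) \<Rightarrow> bool" where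
  "poly_map k A P \<longleftrightarrow> (\<forall>t. gpoly (UNIV \<times> {..k}) (tsz t) (2 ^ (A * tsz t)) (P t))"

definition eval_map ::
  "(rtree \<Rightarrow> (bool \<times> nat \<Rightarrow> rtree \<Rightarrow> complex) \<Rightarrow> complex) \<Rightarrow> 's \<Rightarrow> (nat \<Rightarrow> 's) \<Rightarrow> vfun" where
  "eval_map P x hs \<tau> = (case \<tau> of None \<Rightarrow> 0 | Some t \<Rightarrow> P t (coords x hs))"

lemma coords_bound:
  assumes "x \<in> lc_carrier E" "\<And>i. i < k \<Longrightarrow> hs i \<in> lc_carrier E"
  shows "\<exists>R. \<forall>v \<in> UNIV \<times> {..k}. \<forall>t. cmod (coords x hs v t) \<le> 2 ^ (R * tsz t)"
proof -
  have "\<forall>v \<in> UNIV \<times> {..k}. \<exists>R. \<forall>t. cmod (coords x hs v t) \<le> 2 ^ (R * tsz t)"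
  proof
    fix v :: "bool \<times> nat" assume "v \<in> UNIV \<times> {..k}"
    then obtain b i where v: "v = (b, i)" "i \<le> k" by auto
    have "(case i of 0 \<Rightarrow> x | Suc j \<Rightarrow> hs j) \<in> lc_carrier E"
      using assms v by (auto split: nat.splits)
    then show "\<exists>R. \<forall>t. cmod (coords x hs v t) \<le> 2 ^ (R * tsz t)"
      using Mstar_bound [OF co_Mstar] by (simp add: coords_def v)
  qed
  then obtain R where R: "\<And>v t. v \<in> UNIV \<times> {..k} \<Longrightarrow> cmod (coords x hs v t) \<le> 2 ^ (R v * tsz t)"
    by metis
  have "cmod (coords x hs v t) \<le> 2 ^ ((\<Sum>v \<in> UNIV \<times> {..k}. R v) * tsz t)" if v: "v \<in> UNIV \<times> {..k}" for v t
  proof -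
    have "R v \<le> (\<Sum>v \<in> UNIV \<times> {..k}. R v)"
      using v by (intro member_le_sum) auto
    then have "(2::real) ^ (R v * tsz t) \<le> 2 ^ ((\<Sum>v \<in> UNIV \<times> {..k}. R v) * tsz t)"
      by (intro power_increasing mult_le_mono1) auto
    then show ?thesis using R [OF v] order_trans by blast
  qed
  then show ?thesis by blast
qed

lemma eval_map_Mstar:
  assumes "poly_map k A P" "x \<in> lc_carrier E" "\<And>i. i < k \<Longrightarrow> hs i \<in> lc_carrier E"
  shows "eval_map P x hs \<in> Mstar"
proof -
  obtain R where R: "\<And>v t. v \<in> UNIV \<times> {..k} \<Longrightarrow> cmod (coords x hs v t) \<le> 2 ^ (R * tsz t)"
    using coords_bound [of x k hs] assms(2,3) by blast
  have "cmod (P t (coords x hs)) \<le> 2 ^ (A * tsz t) * 2 ^ (R * tsz t)" for t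
    using assms(1) by (intro growth.gpoly_bound [OF growth_power _ R]) (auto simp: poly_map_def)
  then show ?thesis
    by (intro MstarI [of _ 1 "A + R"]) (simp_all add: eval_map_def distrib_right power_add)
qed

text \<open>As in \<open>ddiff\<close>, the derivative of order \<open>Suc k\<close> moves the point
  along \<open>hs k\<close> and keeps the earlier directions fixed.\<close>

definition dir :: "nat \<Rightarrow> bool \<times> nat \<Rightarrow> (bool \<times> nat) option" where
  "dir k = (\<lambda>(b, i). if i = 0 then Some (b, Suc k) else None)"

lemma coords_shift:
  assumes "x \<in> lc_carrier E" "hs k \<in> lc_carrier E"
  shows "coords (lc_add E x (lc_smul E s (hs k))) hs = shift (dir k) s (coords x hs)"
  using assms
  by (auto simp: fun_eq_iff coords_def shift_def dir_def co_add co_smul smul_closed vadd_def vsmul_def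
      split: nat.splits)

text \<open>The factor \<open>tsz t \<le> 2 ^ tsz t\<close> from \<open>gpoly_deriv\<close> raises
  the exponent \<open>A\<close> by one, so the derivative belongs to the same class in the variables
  extended by \<open>hs k\<close>.\<close>

lemma poly_map_deriv:
  assumes P: "poly_map k A P"
  shows "\<exists>P'. poly_map (Suc k) (Suc A) P' \<and>
    (\<forall>x\<in>lc_carrier E. \<forall>hs. (\<forall>i<Suc k. hs i \<in> lc_carrier E) \<longrightarrow>
      lc_lim MstarS (\<lambda>s. vsmul (inverse s)
        (vsub (eval_map P (lc_add E x (lc_smul E s (hs k))) hs) (eval_map P x hs))) (eval_map P' x hs))"
proof -
  let ?V = "UNIV \<times> {..k} :: (bool \<times> nat) set" and ?W = "UNIV \<times> {..Suc k} :: (bool \<times> nat) set"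
  have VW: "?V \<subseteq> ?W" by auto
  have dirW: "u \<in> ?W" if "v \<in> ?V" "dir k v = Some u" for u v
    using that by (auto simp: dir_def split: if_splits)
  have "\<forall>t. \<exists>p'. gpoly ?W (tsz t) (real (tsz t) * 2 ^ (A * tsz t)) p' \<and>
    (\<forall>S s z. growth S \<and> (\<forall>v\<in>?W. \<forall>t. cmod (z v t) \<le> S (tsz t))
       \<and> (\<forall>v\<in>?V. \<forall>t. cmod (shift (dir k) s z v t) \<le> S (tsz t))
      \<longrightarrow> cmod (P t (shift (dir k) s z) - P t z - s * p' z)
        \<le> (cmod s)\<^sup>2 * ((real (tsz t))\<^sup>2 * 2 ^ (A * tsz t)) * S (tsz t))"
    by (rule allI, rule gpoly_deriv [OF _ VW]) (use P dirW in \<open>auto simp: poly_map_def\<close>)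
  from choice [OF this] obtain P' where *: "\<forall>t. gpoly ?W (tsz t) (real (tsz t) * 2 ^ (A * tsz t)) (P' t) \<and>
    (\<forall>S s z. growth S \<and> (\<forall>v\<in>?W. \<forall>t. cmod (z v t) \<le> S (tsz t))
       \<and> (\<forall>v\<in>?V. \<forall>t. cmod (shift (dir k) s z v t) \<le> S (tsz t))
      \<longrightarrow> cmod (P t (shift (dir k) s z) - P t z - s * P' t z)
        \<le> (cmod s)\<^sup>2 * ((real (tsz t))\<^sup>2 * 2 ^ (A * tsz t)) * S (tsz t))"
    by (elim exE)
  then have P': "\<And>t. gpoly ?W (tsz t) (real (tsz t) * 2 ^ (A * tsz t)) (P' t)"
    and rem: "\<And>t S s z. growth S \<Longrightarrow> (\<And>v t. v \<in> ?W \<Longrightarrow> cmod (z v t) \<le> S (tsz t))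
       \<Longrightarrow> (\<And>v t. v \<in> ?V \<Longrightarrow> cmod (shift (dir k) s z v t) \<le> S (tsz t))
      \<Longrightarrow> cmod (P t (shift (dir k) s z) - P t z - s * P' t z)
        \<le> (cmod s)\<^sup>2 * ((real (tsz t))\<^sup>2 * 2 ^ (A * tsz t)) * S (tsz t)"
    by blast+
  have "real (tsz t) * 2 ^ (A * tsz t) \<le> 2 ^ (Suc A * tsz t)" for t
    using mult_right_mono [OF of_nat_le_two_power [of "tsz t"], of "2 ^ (A * tsz t)"] by (simp add: power_add)
  then have "poly_map (Suc k) (Suc A) P'"
    unfolding poly_map_def using P' gpoly.mono by blast
  moreover have "lc_lim MstarS (\<lambda>s. vsmul (inverse s)
        (vsub (eval_map P (lc_add E x (lc_smul E s (hs k))) hs) (eval_map P x hs))) (eval_map P' x hs)"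
    if x: "x \<in> lc_carrier E" and hs: "\<forall>i<Suc k. hs i \<in> lc_carrier E" for x hs
  proof -
    obtain R where R: "\<And>v t. v \<in> ?W \<Longrightarrow> cmod (coords x hs v t) \<le> 2 ^ (R * tsz t)"
      using coords_bound [of x "Suc k" hs] x hs by blast
    \<comment> \<open>For \<open>cmod s \<le> 1\<close> shifting at most doubles the bound on the
      coordinates, and \<open>2 \<le> 2 ^ tsz t\<close>.\<close>
    let ?S = "\<lambda>n. 2 ^ (Suc R * n) :: real"
    have two: "2 * 2 ^ (R * tsz t) \<le> ?S (tsz t)" for t
    proof -
      have "(2::real) ^ 1 \<le> 2 ^ tsz t"
        using tsz_pos [of t] by (intro power_increasing) auto
      then show ?thesis by (simp add: power_add mult_right_mono)
    qed
    show ?thesis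
    \<comment> \<open>In the exponent, 2 stands for the square of \<open>tsz t\<close>,
      \<open>A\<close> for the coefficients and \<open>Suc R\<close> for \<open>?S\<close>.\<close>
    proof (rule lc_lim_MstarSI [where j = "2 + A + Suc R"])
      show "vsmul (inverse s) (vsub (eval_map P (lc_add E x (lc_smul E s (hs k))) hs) (eval_map P x hs)) \<in> Mstar" for s
        unfolding vsub_eq using P x hs
        by (intro Mstar_vsmul Mstar_vadd eval_map_Mstar [OF P] add_closed smul_closed) auto
      show "eval_map P' x hs \<in> Mstar"
        using calculation x hs by (intro eval_map_Mstar) auto
      fix s :: complex and \<tau> assume s: "s \<noteq> 0" "cmod s \<le> 1"
      show "cmod (vsmul (inverse s) (vsub (eval_map P (lc_add E x (lc_smul E s (hs k))) hs) (eval_map P x hs)) \<tau>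
          - eval_map P' x hs \<tau>) \<le> cmod s * 2 ^ ((2 + A + Suc R) * vsize \<tau>)"
      proof (cases \<tau>)
        case None
        then show ?thesis by (simp add: vsmul_def vsub_def eval_map_def)
      next
        case (Some t)
        let ?z = "coords x hs" and ?n = "tsz t"
        have z: "cmod (?z v t) \<le> ?S (tsz t)" if "v \<in> ?W" for v t
          using R [OF that, of t] two [of t] zero_le_power [of "2::real" "R * tsz t"] by linarith
        have z': "cmod (shift (dir k) s ?z v t) \<le> ?S (tsz t)" if v: "v \<in> ?V" for v t
        proof -
          have "cmod (case dir k v of None \<Rightarrow> 0 | Some u \<Rightarrow> ?z u t) \<le> 2 ^ (R * tsz t)"
            using R dirW [OF v] by (auto split: option.splits)
          then have "cmod (s * (case dir k v of None \<Rightarrow> 0 | Some u \<Rightarrow> ?z u t)) \<le> 1 * 2 ^ (R * tsz t)"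
            unfolding norm_mult using s(2) by (intro mult_mono) auto
          moreover have "cmod (?z v t) \<le> 2 ^ (R * tsz t)"
            using R v by auto
          ultimately show ?thesis
            unfolding shift_def using two [of t] by (intro norm_triangle_le) linarith
        qed
        have "cmod (inverse s * (P t (shift (dir k) s ?z) - P t ?z) - P' t ?z)
            = inverse (cmod s) * cmod (P t (shift (dir k) s ?z) - P t ?z - s * P' t ?z)"
          using s(1) by (simp add: norm_inverse [symmetric] norm_mult [symmetric] right_diff_distrib mult.assoc [symmetric])
        also have "\<dots> \<le> inverse (cmod s) * ((cmod s)\<^sup>2 * ((real ?n)\<^sup>2 * 2 ^ (A * ?n)) * ?S ?n)"
          by (intro mult_left_mono rem growth_power z z') auto
        also have "\<dots> = cmod s * ((real ?n)\<^sup>2 * 2 ^ (A * ?n) * ?S ?n)"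
          using s(1) by (simp add: power2_eq_square)
        also have "\<dots> \<le> cmod s * ((2 ^ ?n)\<^sup>2 * 2 ^ (A * ?n) * ?S ?n)"
          by (intro mult_left_mono mult_right_mono power_mono of_nat_le_two_power) auto
        also have "(2 ^ ?n)\<^sup>2 * 2 ^ (A * ?n) * ?S ?n = 2 ^ ((2 + A + Suc R) * ?n)"
          by (simp add: distrib_right power_add power2_eq_square)
        finally show ?thesis
          using x hs by (simp add: Some vsmul_def vsub_def eval_map_def coords_shift)
      qed
    qed
  qed
  ultimately show ?thesis by blast
qed

text \<open>Nearby points differ from \<open>x\<close> and \<open>hs\<close> by superexponential
  amounts. Since all weights in a monomial add up to \<open>tsz t\<close>, supermultiplicativity
  bounds even products of several such differences by the weight at \<open>tsz t\<close>.\<close>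

lemma continuous_map_eval_map:
  assumes P: "poly_map k A P"
  shows "continuous_map
        (prod_topology (subtopology (lc_top E) (lc_carrier E)) (product_topology (\<lambda>_. lc_top E) {..<k}))
        (lc_top MstarS) (\<lambda>(x, hs). eval_map P x hs)"
proof -
  let ?T = "prod_topology (lc_top E) (product_topology (\<lambda>_. lc_top E) {..<k})"
  have top: "subtopology (lc_top E) (lc_carrier E) = lc_top E"
    by (simp flip: topspace_E)
  have topT: "topspace ?T = lc_carrier E \<times> PiE {..<k} (\<lambda>_. lc_carrier E)"
    by (simp add: topspace_E)
  have "openin ?T {p \<in> topspace ?T. (\<lambda>(x, hs). eval_map P x hs) p \<in> V}"
    if V: "openin (subtopology Mtop Mstar) V" for V
  proof (subst openin_subopen, intro ballI)
    fix p assume "p \<in> {p \<in> topspace ?T. (\<lambda>(x, hs). eval_map P x hs) p \<in> V}"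
    then obtain x hs where p: "p = (x, hs)" and x: "x \<in> lc_carrier E"
      and hs: "hs \<in> PiE {..<k} (\<lambda>_. lc_carrier E)" and inV: "eval_map P x hs \<in> V"
      unfolding topT by auto
    from hs have hsE: "\<And>i. i < k \<Longrightarrow> hs i \<in> lc_carrier E" by auto
    obtain R where R: "\<And>v t. v \<in> UNIV \<times> {..k} \<Longrightarrow> cmod (coords x hs v t) \<le> 2 ^ (R * tsz t)"
      using coords_bound [of x k hs] x hsE by blast
    obtain \<kappa> \<delta> where \<kappa>: "superexp \<kappa>" and \<delta>: "0 < \<delta>"
      and sub: "\<And>y. y \<in> Mstar \<Longrightarrow> (\<And>\<tau>. cmod (y \<tau> - eval_map P x hs \<tau>) \<le> \<delta> * wt \<kappa> (vsize \<tau>)) \<Longrightarrow> y \<in> V"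
      using openin_Mstar_nbhd [OF V inV] by blast
    \<comment> \<open>\<open>A\<close> pays for the coefficients and \<open>R\<close> for the base
      point; the 2 pays for the factor \<open>real ?n\<close> of \<open>gpoly_diff\<close> and for
      the doubling in \<open>S\<close>.\<close>
    define j where "j = A + R + 2"
    define \<kappa>' where "\<kappa>' n = \<kappa> n - j" for n
    have \<kappa>': "superexp \<kappa>'"
      unfolding \<kappa>'_def by (rule superexp_diff [OF \<kappa>])
    obtain D where D: "1 \<le> D" "\<And>n. wt \<kappa>' n * 2 ^ (j * n) \<le> D * wt \<kappa> n"
      using superexp_absorb [OF \<kappa>, of j] unfolding \<kappa>'_def by blast
    \<comment> \<open>The bound 1 keeps the perturbed point below \<open>S\<close>; the factor
      \<open>1 / D\<close> compensates \<open>superexp_absorb\<close>.\<close>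
    define \<delta>' where "\<delta>' = min 1 (\<delta> / D)"
    have \<delta>': "0 < \<delta>'" "\<delta>' \<le> 1" "\<delta>' * D \<le> \<delta>"
      using \<delta> D(1) by (auto simp: \<delta>'_def min_def field_simps)
    obtain U where U: "\<And>y. y \<in> lc_carrier E \<Longrightarrow> openin (lc_top E) (U y)" "\<And>y. y \<in> lc_carrier E \<Longrightarrow> y \<in> U y"
      and near: "\<And>y y' b \<tau>. y \<in> lc_carrier E \<Longrightarrow> y' \<in> U y \<Longrightarrow> cmod (co b y' \<tau> - co b y \<tau>) \<le> \<delta>' * wt \<kappa>' (vsize \<tau>)"
      using co_nbhd [OF \<kappa>' \<delta>'(1)] by metis
    let ?N = "U x \<times> PiE {..<k} (\<lambda>i. U (hs i))"
    have "openin ?T ?N"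
      using U(1) x hsE by (auto simp: openin_prod_Times_iff openin_PiE_gen)
    moreover have "p \<in> ?N"
      using U(2) x hs hsE by (auto simp: p PiE_iff)
    moreover have "?N \<subseteq> {p \<in> topspace ?T. (\<lambda>(x, hs). eval_map P x hs) p \<in> V}"
    proof
      fix q assume q: "q \<in> ?N"
      then have qT: "q \<in> topspace ?T"
        using \<open>openin ?T ?N\<close> openin_subset by blast
      obtain y gs where q': "q = (y, gs)" by (cases q)
      have y: "y \<in> U x" "y \<in> lc_carrier E" and gs: "\<And>i. i < k \<Longrightarrow> gs i \<in> U (hs i)" "\<And>i. i < k \<Longrightarrow> gs i \<in> lc_carrier E"
        using q qT unfolding topT q' by auto
      let ?z = "coords x hs" and ?z' = "coords y gs"
      \<comment> \<open>A common bound for both points: \<open>2 ^ (R * n) + wt \<kappa>' n\<close>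
        is at most twice the product of its terms, and \<open>Suc\<close> takes up the factor
        2.\<close>
      define S where "S = wt (\<lambda>n. \<kappa>' n + Suc R)"
      interpret growth S
        unfolding S_def using \<kappa>' by (intro growth_wt) (auto simp: superexp_def mono_def)
      have S: "2 ^ (R * tsz t) + wt \<kappa>' (tsz t) \<le> S (tsz t)" for t
      proof -
        let ?n = "tsz t"
        have "(2::real) ^ 1 \<le> 2 ^ ?n"
          using tsz_pos [of t] by (intro power_increasing) auto
        then have "2 * (2 ^ (R * ?n) * wt \<kappa>' ?n) \<le> 2 ^ ?n * (2 ^ (R * ?n) * wt \<kappa>' ?n)"
          using wt_pos [of \<kappa>' ?n] by (intro mult_right_mono) auto
        also have "\<dots> = S ?n"
          by (simp add: S_def wt_def distrib_right power_add)
        finally have "2 * (2 ^ (R * ?n) * wt \<kappa>' ?n) \<le> S ?n" .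
        moreover have "2 ^ (R * ?n) * 1 \<le> 2 ^ (R * ?n) * wt \<kappa>' ?n"
          by (intro mult_left_mono wt_ge1) auto
        moreover have "1 * wt \<kappa>' ?n \<le> 2 ^ (R * ?n) * wt \<kappa>' ?n"
          using wt_pos [of \<kappa>' ?n] by (intro mult_right_mono) auto
        ultimately show ?thesis by linarith
      qed
      have dz: "cmod (?z' v t - ?z v t) \<le> \<delta>' * wt \<kappa>' (tsz t)" if v: "v \<in> UNIV \<times> {..k}" for v t
      proof -
        obtain b i where "v = (b, i)" "i \<le> k" using v by auto
        then show ?thesis
          using near [OF x y(1), of b "Some t"] near [OF hsE gs(1), of "i - 1" b "Some t"]
          by (cases i) (auto simp: coords_def)
      qed
      have wt_S: "wt \<kappa>' (tsz t) \<le> S (tsz t)" for t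
        using S [of t] zero_le_power [of "2::real" "R * tsz t"] by linarith
      have z: "cmod (?z v t) \<le> S (tsz t)" if "v \<in> UNIV \<times> {..k}" for v t
        using R [OF that, of t] S [of t] wt_pos [of \<kappa>' "tsz t"] by linarith
      have z': "cmod (?z' v t) \<le> S (tsz t)" if v: "v \<in> UNIV \<times> {..k}" for v t
      proof -
        have "cmod (?z' v t) \<le> cmod (?z v t) + cmod (?z' v t - ?z v t)"
          by (rule norm_triangle_sub)
        moreover have "\<delta>' * wt \<kappa>' (tsz t) \<le> 1 * wt \<kappa>' (tsz t)"
          using \<delta>' wt_pos [of \<kappa>' "tsz t"] by (intro mult_right_mono) auto
        ultimately show ?thesis
          using R [OF v, of t] S [of t] dz [OF v, of t] by linarith
      qed
      have "eval_map P y gs \<in> V"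
      proof (rule sub)
        show "eval_map P y gs \<in> Mstar"
          by (rule eval_map_Mstar [OF P y(2) gs(2)])
        fix \<tau>
        show "cmod (eval_map P y gs \<tau> - eval_map P x hs \<tau>) \<le> \<delta> * wt \<kappa> (vsize \<tau>)"
        proof (cases \<tau>)
          case None
          then show ?thesis using \<delta> wt_pos [of \<kappa> 0] by (simp add: eval_map_def)
        next
          case (Some t)
          let ?n = "tsz t"
          have "cmod (P t ?z' - P t ?z) \<le> \<delta>' * (real ?n * 2 ^ (A * ?n)) * S ?n"
          proof (rule gpoly_diff [OF _ _ z z'])
            show "gpoly (UNIV \<times> {..k}) ?n (2 ^ (A * ?n)) (P t)"
              using P by (simp add: poly_map_def)
            show "cmod (?z' v t - ?z v t) \<le> \<delta>' * S (tsz t)" if "v \<in> UNIV \<times> {..k}" for v t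
              using dz [OF that, of t] mult_left_mono [OF wt_S [of t], of \<delta>'] \<delta>'(1) by linarith
          qed (use \<delta>' in auto)
          also have "\<dots> \<le> \<delta>' * (2 ^ ?n * 2 ^ (A * ?n)) * S ?n"
            using \<delta>'(1) nonneg by (intro mult_left_mono mult_right_mono of_nat_le_two_power) auto
          also have "\<dots> = \<delta>' * (wt \<kappa>' ?n * 2 ^ (j * ?n))"
            by (simp add: S_def j_def wt_def distrib_right power_add power2_eq_square)
          also have "\<dots> \<le> \<delta>' * (D * wt \<kappa> ?n)"
            using \<delta>'(1) D(2) by (intro mult_left_mono) auto
          also have "\<dots> \<le> \<delta> * wt \<kappa> ?n"
            using mult_right_mono [OF \<delta>'(3), of "wt \<kappa> ?n"] wt_pos [of \<kappa> ?n] by (simp add: mult.assoc)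
          finally show ?thesis by (simp add: Some eval_map_def)
        qed
      qed
      then show "q \<in> {p \<in> topspace ?T. (\<lambda>(x, hs). eval_map P x hs) p \<in> V}"
        using qT by (simp add: q')
    qed
    ultimately show "\<exists>T. openin ?T T \<and> p \<in> T \<and> T \<subseteq> {p \<in> topspace ?T. (\<lambda>(x, hs). eval_map P x hs) p \<in> V}"
      by blast
  qed
  moreover have "eval_map P x hs \<in> Mstar" if "(x, hs) \<in> topspace ?T" for x hs
    using that unfolding topT by (intro eval_map_Mstar [OF P]) auto
  ultimately show ?thesis
    unfolding top continuous_map_def using Mstar_subset_Mspace
    by (auto simp del: topspace_prod_topology)
qed

text \<open>At each order the limit is identified by uniqueness. The hypothesis at order
  \<open>k\<close> applies inside the difference quotient because the carrier is closed under the
  operations.\<close>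

lemma ddiff_eq_eval_map:
  assumes P: "poly_map 0 A P" and F: "\<And>x hs. x \<in> lc_carrier E \<Longrightarrow> F x = eval_map P x hs"
  shows "\<exists>B Q. poly_map k B Q \<and> (\<forall>x\<in>lc_carrier E. \<forall>hs. (\<forall>i<k. hs i \<in> lc_carrier E) \<longrightarrow>
    ddiff E MstarS F k x hs = eval_map Q x hs)"
proof (induction k)
  case 0
  then show ?case using P F by auto
next
  case (Suc k)
  then obtain B Q where Q: "poly_map k B Q"
    and eq: "\<And>x hs. x \<in> lc_carrier E \<Longrightarrow> (\<And>i. i < k \<Longrightarrow> hs i \<in> lc_carrier E) \<Longrightarrow> ddiff E MstarS F k x hs = eval_map Q x hs"
    by blast
  from poly_map_deriv [OF Q] obtain Q' where Q': "poly_map (Suc k) (Suc B) Q'"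
    and lim: "\<And>x hs. x \<in> lc_carrier E \<Longrightarrow> (\<And>i. i < Suc k \<Longrightarrow> hs i \<in> lc_carrier E) \<Longrightarrow>
      lc_lim MstarS (\<lambda>s. vsmul (inverse s)
        (vsub (eval_map Q (lc_add E x (lc_smul E s (hs k))) hs) (eval_map Q x hs))) (eval_map Q' x hs)"
    by blast
  have "ddiff E MstarS F (Suc k) x hs = eval_map Q' x hs"
    if "x \<in> lc_carrier E" "\<And>i. i < Suc k \<Longrightarrow> hs i \<in> lc_carrier E" for x hs
  proof -
    have L: "lc_lim MstarS (\<lambda>t. lc_smul MstarS (inverse t) (lc_sub MstarS
        (ddiff E MstarS F k (lc_add E x (lc_smul E t (hs k))) hs) (ddiff E MstarS F k x hs))) (eval_map Q' x hs)"
      using lim [of x hs] that by (simp add: eq add_closed smul_closed)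
    show ?thesis
      unfolding ddiff.simps using L lc_lim_MstarS_unique [OF _ L] by (rule the_equality)
  qed
  then show ?case using Q' by blast
qed

lemma smoothC_eval_map:
  assumes P: "poly_map 0 A P" and F: "\<And>x hs. x \<in> lc_carrier E \<Longrightarrow> F x = eval_map P x hs"
  shows "smoothC E MstarS (lc_carrier E) F"
  unfolding smoothC_def
proof (intro conjI allI ballI)
  show "openin (lc_top E) (lc_carrier E)"
    using openin_topspace [of "lc_top E"] by (simp add: topspace_E)
next
  fix k x and hs :: "nat \<Rightarrow> 's"
  assume x: "x \<in> lc_carrier E" and "hs \<in> PiE {..<Suc k} (\<lambda>_. lc_carrier E)"
  then have hs: "\<And>i. i < Suc k \<Longrightarrow> hs i \<in> lc_carrier E" by auto
  obtain B Q where Q: "poly_map k B Q"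
    and eq: "\<And>x hs. x \<in> lc_carrier E \<Longrightarrow> (\<And>i. i < k \<Longrightarrow> hs i \<in> lc_carrier E) \<Longrightarrow> ddiff E MstarS F k x hs = eval_map Q x hs"
    using ddiff_eq_eval_map [OF P F] by blast
  from poly_map_deriv [OF Q] obtain Q' where
    "lc_lim MstarS (\<lambda>s. vsmul (inverse s)
        (vsub (eval_map Q (lc_add E x (lc_smul E s (hs k))) hs) (eval_map Q x hs))) (eval_map Q' x hs)"
    using x hs by blast
  then show "\<exists>L. lc_lim MstarS (\<lambda>t. lc_smul MstarS (inverse t)
          (lc_sub MstarS (ddiff E MstarS F k (lc_add E x (lc_smul E t (hs k))) hs) (ddiff E MstarS F k x hs))) L"
    using x hs by (auto simp: eq add_closed smul_closed)
next
  fix k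
  obtain B Q where Q: "poly_map k B Q"
    and eq: "\<And>x hs. x \<in> lc_carrier E \<Longrightarrow> (\<And>i. i < k \<Longrightarrow> hs i \<in> lc_carrier E) \<Longrightarrow> ddiff E MstarS F k x hs = eval_map Q x hs"
    using ddiff_eq_eval_map [OF P F] by blast
  show "continuous_map
        (prod_topology (subtopology (lc_top E) (lc_carrier E)) (product_topology (\<lambda>_. lc_top E) {..<k}))
        (lc_top MstarS) (\<lambda>(x, hs). ddiff E MstarS F k x hs)"
    by (rule continuous_map_eq [OF continuous_map_eval_map [OF Q]])
      (auto simp: topspace_E PiE_iff intro!: eq [symmetric])
qed

end

section \<open>Product and inverse in the chart\<close>

interpretation Mstar_coord: coord_space MstarS "\<lambda>_ x. x"
proof
  fix \<kappa> and \<delta> :: real and x assume "superexp \<kappa>" "0 < \<delta>" "x \<in> lc_carrier MstarS"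
  then show "\<exists>U. openin (lc_top MstarS) U \<and> x \<in> U \<and>
      (\<forall>y\<in>U. \<forall>(b::bool) \<tau>. cmod (y \<tau> - x \<tau>) \<le> \<delta> * wt \<kappa> (vsize \<tau>))"
    using Mstar_nbhd_openin by simp
qed (use Mstar_subset_Mspace in \<open>auto simp: Mstar_vadd Mstar_vsmul\<close>)

interpretation Mstar2_coord: coord_space Mstar2S "\<lambda>b p. if b then fst p else snd p"
proof
  fix \<kappa> and \<delta> :: real and x assume \<kappa>: "superexp \<kappa>" "0 < \<delta>" and "x \<in> lc_carrier Mstar2S"
  then obtain a b where x: "x = (a, b)" "a \<in> Mstar" "b \<in> Mstar"
    by (auto simp: Mstar2S_def)
  obtain U V where "openin (subtopology Mtop Mstar) U" "a \<in> U"
      "\<forall>y\<in>U. \<forall>\<tau>. cmod (y \<tau> - a \<tau>) \<le> \<delta> * wt \<kappa> (vsize \<tau>)"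
      "openin (subtopology Mtop Mstar) V" "b \<in> V"
      "\<forall>y\<in>V. \<forall>\<tau>. cmod (y \<tau> - b \<tau>) \<le> \<delta> * wt \<kappa> (vsize \<tau>)"
    using Mstar_nbhd_openin [OF \<kappa>] x by metis
  then show "\<exists>U. openin (lc_top Mstar2S) U \<and> x \<in> U \<and>
      (\<forall>y\<in>U. \<forall>(b::bool) \<tau>. cmod ((if b then fst y else snd y) \<tau> - (if b then fst x else snd x) \<tau>)
        \<le> \<delta> * wt \<kappa> (vsize \<tau>))"
    using x by (intro exI [of _ "U \<times> V"]) (auto simp: Mstar2S_def openin_prod_Times_iff)
qed (use Mstar_subset_Mspace in \<open>auto simp: Mstar2S_def Mstar_vadd Mstar_vsmul\<close>)

lemma Psi_inv_simps [simp]: "Psi_inv x None = x None + 1" "Psi_inv x (Some t) = x (Some t)"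
  by (simp_all add: Psi_inv_def vadd_def)

lemma Psi_simps [simp]: "Psi x None = x None - 1" "Psi x (Some t) = x (Some t)"
  by (simp_all add: Psi_def vsub_def)

lemma gpoly_monomial:
  assumes "u \<in> V" "v \<in> V"
  shows "gpoly V (tsz s + fsz f) 1 (\<lambda>z. z u s * (\<Prod>\<theta>\<in>#f. z v \<theta>))"
  using gpoly.mult [OF gpoly.var [OF assms(1)] gpoly_prod_mset [OF assms(2)], of s f] by (simp add: fsz_def)

text \<open>In the chart the value at the empty tree is the constant 1, so only nonempty trees index
  variables. No direction variable occurs at order 0, hence the equation for all
  \<open>hs\<close>.\<close>

lemma bmult_eval_map:
  "\<exists>P. Mstar2_coord.poly_map 0 1 P \<and> (\<forall>p\<in>lc_carrier Mstar2S. \<forall>hs.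
    (case p of (x, y) \<Rightarrow> Psi (bmult (Psi_inv x) (Psi_inv y))) = Mstar2_coord.eval_map P p hs)"
proof (intro exI conjI ballI allI)
  \<comment> \<open>\<open>True\<close> marks the left factor, \<open>False\<close> the right one;
    the first summand is the empty subtree, with \<open>Psi_inv y None = 1\<close>.\<close>
  let ?P = "\<lambda>t (z :: bool \<times> nat \<Rightarrow> rtree \<Rightarrow> complex).
    z (True, 0) t + (\<Sum>p\<in>#ost t. z (False, 0) (fst p) * (\<Prod>\<theta>\<in>#snd p. z (True, 0) \<theta>))"
  show "Mstar2_coord.poly_map 0 1 ?P"
    unfolding Mstar2_coord.poly_map_def
  proof
    fix t
    have "gpoly (UNIV \<times> {..0::nat}) (tsz t) (1 + real (size (ost t))) (?P t)"
    proof (intro gpoly.add gpoly_sum_mset)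
      show "gpoly (UNIV \<times> {..0::nat}) (tsz t) 1 (\<lambda>z. z (True, 0) t)"
        by (rule gpoly.var) simp
      show "gpoly (UNIV \<times> {..0::nat}) (tsz t) 1 (\<lambda>z. z (False, 0) (fst p) * (\<Prod>\<theta>\<in>#snd p. z (True, 0) \<theta>))"
        if "p \<in># ost t" for p
        using gpoly_monomial [of "(False, 0)" "UNIV \<times> {..0::nat}" "(True, 0)" "fst p" "snd p"] tsz_ost [of "fst p" "snd p" t] that
        by simp
    qed
    moreover have "1 + real (size (ost t)) \<le> 2 ^ (1 * tsz t)"
      using size_ost [of t] by (metis mult_1 of_nat_Suc of_nat_le_iff of_nat_numeral of_nat_power)
    ultimately show "gpoly (UNIV \<times> {..0::nat}) (tsz t) (2 ^ (1 * tsz t)) (?P t)"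
      by (rule gpoly.mono)
  qed
  fix p hs assume "p \<in> lc_carrier Mstar2S"
  then obtain x y where p: "p = (x, y)" "x \<in> Mstar" "y \<in> Mstar" by (auto simp: Mstar2S_def)
  then show "(case p of (x, y) \<Rightarrow> Psi (bmult (Psi_inv x) (Psi_inv y))) = Mstar2_coord.eval_map ?P p hs"
    by (auto simp: fun_eq_iff Mstar2_coord.eval_map_def Mstar2_coord.coords_def bmult_def Mstar_def
        case_prod_unfold split: option.splits)
qed

lemma binv_eval_map:
  "\<exists>P. Mstar_coord.poly_map 0 1 P \<and>
    (\<forall>x\<in>lc_carrier MstarS. \<forall>hs. Psi (binv (Psi_inv x)) = Mstar_coord.eval_map P x hs)"
proof (intro exI conjI ballI allI)
  let ?P = "\<lambda>t (z :: bool \<times> nat \<Rightarrow> rtree \<Rightarrow> complex).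
    \<Sum>p\<in>#cuts t. (-1) ^ (size (snd p) + 1) * (z (True, 0) (fst p) * (\<Prod>\<theta>\<in>#snd p. z (True, 0) \<theta>))"
  show "Mstar_coord.poly_map 0 1 ?P"
    unfolding Mstar_coord.poly_map_def
  proof
    fix t
    have "gpoly (UNIV \<times> {..0::nat}) (tsz t) (size (cuts t)) (?P t)"
    proof (intro gpoly_sum_mset)
      fix p assume p: "p \<in># cuts t"
      have "gpoly (UNIV \<times> {..0::nat}) (tsz (fst p) + fsz (snd p)) 1
          (\<lambda>z. z (True, 0) (fst p) * (\<Prod>\<theta>\<in>#snd p. z (True, 0) \<theta>))"
        by (rule gpoly_monomial) auto
      then have "gpoly (UNIV \<times> {..0::nat}) (0 + (tsz (fst p) + fsz (snd p))) (cmod ((-1) ^ (size (snd p) + 1)) * 1)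
          (\<lambda>z. (-1) ^ (size (snd p) + 1) * (z (True, 0) (fst p) * (\<Prod>\<theta>\<in>#snd p. z (True, 0) \<theta>)))"
        by (rule gpoly.mult [OF gpoly.const])
      then show "gpoly (UNIV \<times> {..0::nat}) (tsz t) 1
          (\<lambda>z. (-1) ^ (size (snd p) + 1) * (z (True, 0) (fst p) * (\<Prod>\<theta>\<in>#snd p. z (True, 0) \<theta>)))"
        using tsz_cuts [of "fst p" "snd p" t] p by (simp add: norm_power)
    qed
    moreover have "real (size (cuts t)) \<le> 2 ^ (1 * tsz t)"
      using size_cuts [of t] by (metis mult_1 of_nat_le_iff of_nat_numeral of_nat_power)
    ultimately show "gpoly (UNIV \<times> {..0::nat}) (tsz t) (2 ^ (1 * tsz t)) (?P t)"
      by (rule gpoly.mono)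
  qed
  fix x hs assume "x \<in> lc_carrier MstarS"
  then show "Psi (binv (Psi_inv x)) = Mstar_coord.eval_map ?P x hs"
    by (auto simp: fun_eq_iff Mstar_coord.eval_map_def Mstar_coord.coords_def binv_def
        case_prod_unfold split: option.splits)
qed

lemma smoothC_bmult:
  "smoothC Mstar2S MstarS (Mstar \<times> Mstar) (\<lambda>(x, y). Psi (bmult (Psi_inv x) (Psi_inv y)))"
proof -
  from bmult_eval_map obtain P where "Mstar2_coord.poly_map 0 1 P"
    "\<forall>p\<in>lc_carrier Mstar2S. \<forall>hs.
      (case p of (x, y) \<Rightarrow> Psi (bmult (Psi_inv x) (Psi_inv y))) = Mstar2_coord.eval_map P p hs"
    by blast
  then have "smoothC Mstar2S MstarS (lc_carrier Mstar2S) (\<lambda>(x, y). Psi (bmult (Psi_inv x) (Psi_inv y)))"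
    by (intro Mstar2_coord.smoothC_eval_map) auto
  then show ?thesis by (simp add: Mstar2S_def)
qed

lemma smoothC_binv: "smoothC MstarS MstarS Mstar (\<lambda>x. Psi (binv (Psi_inv x)))"
proof -
  from binv_eval_map obtain P where "Mstar_coord.poly_map 0 1 P"
    "\<forall>x\<in>lc_carrier MstarS. \<forall>hs. Psi (binv (Psi_inv x)) = Mstar_coord.eval_map P x hs"
    by blast
  then have "smoothC MstarS MstarS (lc_carrier MstarS) (\<lambda>x. Psi (binv (Psi_inv x)))"
    by (intro Mstar_coord.smoothC_eval_map) auto
  then show ?thesis by simp
qed

section \<open>The tame group as a translate of \<open>Mstar\<close>\<close>

lemma tameB_iff: "a \<in> tameB \<longleftrightarrow> a None = 1 \<and> Psi a \<in> Mstar"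
proof (intro iffI conjI; (elim conjE)?)
  assume a: "a \<in> tameB"
  then show "a None = 1" by (simp add: tameB_def)
  from a obtain C K where CK: "0 < C" "0 < K" "\<And>\<tau>. \<tau> \<noteq> None \<Longrightarrow> cmod (a \<tau>) \<le> C * K ^ vsize \<tau>"
    by (auto simp: tameB_def)
  obtain m where m: "K < 2 ^ m"
    using real_arch_pow [of 2] by auto
  show "Psi a \<in> Mstar"
  proof (rule MstarI)
    show "Psi a None = 0" using \<open>a None = 1\<close> by simp
    fix t
    have "C * K ^ tsz t \<le> C * (2 ^ m) ^ tsz t"
      using CK(1,2) m by (intro mult_left_mono power_mono) auto
    then show "cmod (Psi a (Some t)) \<le> C * 2 ^ (m * tsz t)"
      using CK(3) [of "Some t"] by (simp add: power_mult)
  qed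
next
  assume a: "a None = 1" "Psi a \<in> Mstar"
  from Mstar_bound [OF a(2)] obtain R where R: "\<And>t. cmod (a (Some t)) \<le> 2 ^ (R * tsz t)"
    by auto
  then have "\<And>\<tau>. \<tau> \<noteq> None \<Longrightarrow> cmod (a \<tau>) \<le> 1 * (2 ^ R) ^ vsize \<tau>"
    by (auto simp: power_mult)
  then show "a \<in> tameB"
    unfolding tameB_def using a(1) by (intro CollectI conjI exI [of _ 1] exI [of _ "2 ^ R"]) auto
qed

lemma Psi_inv_Psi [simp]: "Psi_inv (Psi a) = a"
  by (simp add: Psi_inv_def Psi_def vadd_def vsub_def)

lemma Psi_Psi_inv [simp]: "Psi (Psi_inv a) = a"
  by (simp add: Psi_inv_def Psi_def vadd_def vsub_def)

lemma bunit_Mspace: "bunit \<in> Mspace"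
proof -
  have "cmod (bunit \<tau>) \<le> 1 * 2 ^ (0 * vsize \<tau>)" for \<tau>
    by (simp add: bunit_def)
  then show ?thesis unfolding Mspace_iff by blast
qed

lemma tameB_eq: "tameB = Psi_inv ` Mstar"
proof
  show "tameB \<subseteq> Psi_inv ` Mstar"
    unfolding tameB_iff by (metis Psi_inv_Psi image_eqI subsetI tameB_iff)
  show "Psi_inv ` Mstar \<subseteq> tameB"
    by (auto simp: tameB_iff) (simp add: Mstar_def)
qed

lemma tameB_subset_Mspace: "tameB \<subseteq> Mspace"
  unfolding tameB_eq Psi_inv_def using Mspace_vadd bunit_Mspace Mstar_subset_Mspace by blast

text \<open>Translations preserve differences, so the same \<kappa> and \<delta> serve on both
  sides. The form of the premise covers \<open>Psi\<close> and \<open>Psi_inv\<close> alike.\<close>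

lemma continuous_map_translation:
  assumes f: "\<And>x. x \<in> Mspace \<Longrightarrow> f x \<in> Mspace" and diff: "\<And>x y \<tau>. f y \<tau> - f x \<tau> = y \<tau> - x \<tau>"
  shows "continuous_map Mtop Mtop f"
  unfolding continuous_map_def
proof (intro conjI allI impI)
  fix V assume V: "openin Mtop V"
  show "openin Mtop {x \<in> topspace Mtop. f x \<in> V}"
  proof (subst openin_subopen, intro ballI)
    fix x assume x: "x \<in> {x \<in> topspace Mtop. f x \<in> V}"
    then obtain \<kappa> \<delta> where \<kappa>: "superexp \<kappa>" "0 < \<delta>"
      and sub: "\<And>y. y \<in> Mspace \<Longrightarrow> (\<And>\<tau>. cmod (y \<tau> - f x \<tau>) \<le> \<delta> * wt \<kappa> (vsize \<tau>)) \<Longrightarrow> y \<in> V"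
      using openin_Mtop_nbhd [OF V] by blast
    obtain U where U: "openin Mtop U" "x \<in> U" "\<And>y \<tau>. y \<in> U \<Longrightarrow> cmod (y \<tau> - x \<tau>) \<le> \<delta> * wt \<kappa> (vsize \<tau>)"
      using Mtop_nbhd_openin [OF \<kappa>, of x] x by auto
    have "U \<subseteq> {x \<in> topspace Mtop. f x \<in> V}"
      using openin_subset [OF U(1)] U(3) f by (auto intro!: sub simp: diff)
    then show "\<exists>T. openin Mtop T \<and> x \<in> T \<and> T \<subseteq> {x \<in> topspace Mtop. f x \<in> V}"
      using U by blast
  qed
qed (use f in auto)

lemma homeomorphic_map_Psi: "homeomorphic_map (subtopology Mtop tameB) (subtopology Mtop Mstar) Psi"
proof (rule homeomorphic_maps_imp_map)
  show "homeomorphic_maps (subtopology Mtop tameB) (subtopology Mtop Mstar) Psi Psi_inv"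
    unfolding homeomorphic_maps_def
  proof (intro conjI ballI)
    have "continuous_map Mtop Mtop Psi" "continuous_map Mtop Mtop Psi_inv"
      by (rule continuous_map_translation;
          simp add: Psi_def Psi_inv_def Mspace_vsub Mspace_vadd bunit_Mspace; simp add: vsub_def vadd_def)+
    then show "continuous_map (subtopology Mtop tameB) (subtopology Mtop Mstar) Psi"
      "continuous_map (subtopology Mtop Mstar) (subtopology Mtop tameB) Psi_inv"
      by (auto simp: continuous_map_in_subtopology continuous_map_from_subtopology tameB_iff)
        (auto simp: Mstar_def)
  qed auto
qed

text \<open>Closure under the product comes from the polynomial description: at order 0,
  \<open>eval_map_Mstar\<close> already provides the exponential bound.\<close>

lemma bmult_tameB:
  assumes "a \<in> tameB" "b \<in> tameB"
  shows "bmult a b \<in> tameB"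
proof -
  from bmult_eval_map obtain P where "Mstar2_coord.poly_map 0 1 P"
    and "\<And>p hs. p \<in> lc_carrier Mstar2S \<Longrightarrow>
      (case p of (x, y) \<Rightarrow> Psi (bmult (Psi_inv x) (Psi_inv y))) = Mstar2_coord.eval_map P p hs"
    by blast
  then have "(case (Psi a, Psi b) of (x, y) \<Rightarrow> Psi (bmult (Psi_inv x) (Psi_inv y))) \<in> Mstar"
    using assms by (metis (no_types, lifting) Mstar2_coord.eval_map_Mstar Mstar2S_def SigmaI lcs.select_convs(1)
      not_less_zero tameB_iff)
  then show ?thesis using assms by (simp add: tameB_iff)
qed

lemma binv_tameB:
  assumes "a \<in> tameB"
  shows "binv a \<in> tameB"
proof -
  from binv_eval_map obtain P where "Mstar_coord.poly_map 0 1 P"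
    and "\<And>x hs. x \<in> lc_carrier MstarS \<Longrightarrow> Psi (binv (Psi_inv x)) = Mstar_coord.eval_map P x hs"
    by blast
  then have "Psi (binv (Psi_inv (Psi a))) \<in> Mstar"
    using assms by (metis Mstar_coord.eval_map_Mstar MstarS_simps(1) not_less_zero tameB_iff)
  then show ?thesis by (simp add: tameB_iff)
qed

lemma bunit_tameB: "bunit \<in> tameB"
  unfolding tameB_iff by (auto intro!: MstarI [of _ 0 0])

lemma tameB_None: "a \<in> tameB \<Longrightarrow> a None = 1"
  by (simp add: tameB_iff)

theorem theorem2p4:
  shows "bunit \<in> tameB
    \<and> (\<forall>a\<in>tameB. \<forall>b\<in>tameB. bmult a b \<in> tameB)
    \<and> (\<forall>a\<in>tameB. binv a \<in> tameB)
    \<and> (\<forall>a\<in>tameB. \<forall>b\<in>tameB. \<forall>c\<in>tameB. bmult (bmult a b) c = bmult a (bmult b c))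
    \<and> (\<forall>a\<in>tameB. bmult bunit a = a \<and> bmult a bunit = a)
    \<and> (\<forall>a\<in>tameB. bmult a (binv a) = bunit \<and> bmult (binv a) a = bunit)
    \<and> tameB \<subseteq> Mspace
    \<and> homeomorphic_map (subtopology Mtop tameB) (subtopology Mtop Mstar) Psi
    \<and> smoothC Mstar2S MstarS (Mstar \<times> Mstar)
        (\<lambda>(x, y). Psi (bmult (Psi_inv x) (Psi_inv y)))
    \<and> smoothC MstarS MstarS Mstar (\<lambda>x. Psi (binv (Psi_inv x)))"
  using bunit_tameB bmult_tameB binv_tameB bmult_assoc bmult_bunit_left bmult_bunit_right
    bmult_binv_left bmult_binv_right tameB_subset_Mspace homeomorphic_map_Psi smoothC_bmult smoothC_binv
  by (simp add: tameB_None)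

end
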